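(* Let $T>0$ and $d\ge 6$. Suppose that $a\in C^{d+1}[0,T]$, $K\in C^{d+1}[0,T]$, $K(0)=1$, and $a^{(p)}(0)=0$ for $p=0,1,\dots,d+1$. Let $u$ be the solution of $\int_0^t K(t')\,u(t-t')\,dt'=a(t)$, $t\in[0,T]$, and let $e_n(t)$ be the approximation error of the modified cubic convolution spline scheme (cubic splines with parabolic runout conditions at $t=0$) with time step $h$. Then there exists a constant $C$, independent of $n$ and $h$, such that for all sufficiently small $h$ and all $n\ge1$ with $t_n=nh\le T$, $$|e_n(t)|\le C\,h^4\qquad\text{for all } t\in[t_1,t_n].$$
   Context: Under the stated hypotheses the Volterra equation $\int_0^t K(t')\,u(t-t')\,dt'=a(t)$, $t\in[0,T]$, has a unique solution $u\in C^d[0,T]$, extended by zero to the negative real axis. Basis functions. Define $b^0(\tau)=1$ for $\tau\in[0,1)$ and $0$ otherwise, and for $k\ge1$, $b^k(\tau)=\frac{\tau}{k}\,b^{k-1}(\tau)+\frac{k+1-\tau}{k}\,b^{k-1}(\tau-1)$. Let $B(t)=b^3(t+2)$ be the centred cubic B-spline, supported on $[-2,2]$. The modified cubic spline basis functions on $[0,\infty)$ are $$\phi_0(t)=B(t)+3B(t+1),\quad \phi_1(t)=B(t-1)-3B(t+1),\quad \phi_2(t)=B(t-2)+B(t+1),\quad \phi_j(t)=B(t-j)\ \ (j\ge3).$$ Scheme. With time step $h>0$ and $t_n=nh$, the weights are $q_j=\int_0^\infty K(t)\,\phi_j(t/h)\,dt$, and the coefficients $v_j$ are determined by $\sum_{j=0}^n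 q_j\,v_{n-j}=a(t_n)$ for $n\ge0$, $t_n\le T$ (so $v_0=0$). The kernel $K$ is understood to be defined and locally integrable on $[0,\infty)$ (the smoothness being required only on $[0,T]$), so that the weights make sense. The approximation at time $t_n$ is $U_n(t_n-t)=\sum_{j=0}^n v_{n-j}\,\phi_j(t/h)$ for $t\ge0$, and the approximation error is $e_n(t)=u(t_n-t)-U_n(t_n-t)$. *)

theory Defs
  imports "HOL-Analysis.Analysis"
begin

text \<open>
  Iterated derivatives relative to a set \<open>S\<close>, so that at the endpoints of a compact interval the
  one-sided derivatives are taken. The values are meaningful only at points of \<open>S\<close>.
\<close>
primrec nth_deriv_within :: "real set \<Rightarrow> nat \<Rightarrow> (real \<Rightarrow> real) \<Rightarrow> real \<Rightarrow> real" where
  "nth_deriv_within S 0 f = f"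
| "nth_deriv_within S (Suc p) f =
     (\<lambda>x. vector_derivative (nth_deriv_within S p f) (at x within S))"

definition C_on :: "nat \<Rightarrow> real set \<Rightarrow> (real \<Rightarrow> real) \<Rightarrow> bool" where
  "C_on k S f \<longleftrightarrow>
     (\<forall>p<k. nth_deriv_within S p f differentiable_on S) \<and>
     continuous_on S (nth_deriv_within S k f)"

definition locally_integrable_halfline :: "(real \<Rightarrow> real) \<Rightarrow> bool" where
  "locally_integrable_halfline K \<longleftrightarrow> (\<forall>R. K absolutely_integrable_on {0..R})"

definition volterra_solution ::
  "nat \<Rightarrow> real \<Rightarrow> (real \<Rightarrow> real) \<Rightarrow> (real \<Rightarrow> real) \<Rightarrow> (real \<Rightarrow> real) \<Rightarrow> bool" where
  "volterra_solution d T K a u \<longleftrightarrow>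
     C_on d {0..T} u \<and> (\<forall>t<0. u t = 0) \<and>
     (\<forall>t\<in>{0..T}. integral {0..t} (\<lambda>s. K s * u (t - s)) = a t)"

primrec bspline :: "nat \<Rightarrow> real \<Rightarrow> real" where
  "bspline 0 x = (if 0 \<le> x \<and> x < 1 then 1 else 0)"
| "bspline (Suc k) x =
     x / real (Suc k) * bspline k x +
     (real (Suc k) + 1 - x) / real (Suc k) * bspline k (x - 1)"

definition centred_cubic :: "real \<Rightarrow> real" where
  "centred_cubic t = bspline 3 (t + 2)"

text \<open>
  The basis functions live on the half-line \<open>t \<ge> 0\<close>; the formulas are not cut off for \<open>t < 0\<close>,
  and their values there are not used. The linear combinations for \<open>j \<le> 2\<close> encode the parabolic
  runout conditions at \<open>t = 0\<close>.
\<close>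
definition runout_basis :: "nat \<Rightarrow> real \<Rightarrow> real" where
  "runout_basis j t =
     (if j = 0 then centred_cubic t + 3 * centred_cubic (t + 1)
      else if j = 1 then centred_cubic (t - 1) - 3 * centred_cubic (t + 1)
      else if j = 2 then centred_cubic (t - 2) + centred_cubic (t + 1)
      else centred_cubic (t - real j))"

definition weight :: "(real \<Rightarrow> real) \<Rightarrow> real \<Rightarrow> nat \<Rightarrow> real" where
  "weight K h j = integral {0..} (\<lambda>t. K t * runout_basis j (t / h))"

text \<open>
  For small \<open>h\<close> the weight \<open>weight K h 0\<close> is nonzero, so this determines \<open>v j\<close> for all \<open>j\<close> with
  \<open>j h \<le> T\<close>; the remaining values of \<open>v\<close> are unconstrained and never used.
\<close>
definition scheme_coefficients ::
  "real \<Rightarrow> (real \<Rightarrow> real) \<Rightarrow> (real \<Rightarrow> real) \<Rightarrow> real \<Rightarrow> (nat \<Rightarrow> real) \<Rightarrow> bool" where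
  "scheme_coefficients T K a h v \<longleftrightarrow>
     (\<forall>n. real n * h \<le> T \<longrightarrow> (\<Sum>j=0..n. weight K h j * v (n - j)) = a (real n * h))"

text \<open>
  \<open>approx h v n s\<close> is the approximation \<open>U\<^sub>n\<close> evaluated at \<open>s = t\<^sub>n - t\<close>.
\<close>
definition approx :: "real \<Rightarrow> (nat \<Rightarrow> real) \<Rightarrow> nat \<Rightarrow> real \<Rightarrow> real" where
  "approx h v n s = (\<Sum>j=0..n. v (n - j) * runout_basis j ((real n * h - s) / h))"

definition approx_error ::
  "(real \<Rightarrow> real) \<Rightarrow> real \<Rightarrow> (nat \<Rightarrow> real) \<Rightarrow> nat \<Rightarrow> real \<Rightarrow> real" where
  "approx_error u h v n t = u (real n * h - t) - approx h v n (real n * h - t)"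

end

theory Submission
  imports Defs
begin

text \<open>
  With \<open>W x = u x - h\<^sup>2 / 6 * u'' x\<close> (and \<open>u\<close> extended by zero), the spline with coefficients
  \<open>W (t\<^sub>k)\<close> reproduces cubics, so it approximates \<open>u\<close> to order \<open>h\<^sup>4\<close> away from the runout interval;
  it remains to show \<open>v\<^sub>k = W (t\<^sub>k) + O(h\<^sup>4)\<close>. Differencing the scheme in \<open>n\<close> and dividing by \<open>h\<close>
  gives a recursion for \<open>v\<^sub>k - W (t\<^sub>k)\<close> whose right-hand side is \<open>O(h\<^sup>4)\<close> and whose coefficients are, up
  to \<open>O(h)\<close>, those of \<open>(15 + 5 z + 5 z\<^sup>2 - z\<^sup>3) / 24\<close>. Since \<open>15 > 5 + 5 + 1\<close>, the recursion is stable.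
  The weights near \<open>t\<^sub>n = T\<close> involve values of \<open>K\<close> beyond \<open>T\<close>, where it is merely integrable, but
  these multiply only \<open>v\<^sub>0 = 0\<close> and the tiny \<open>v\<^sub>1\<close>, so \<open>K\<close> may be replaced by a Lipschitz extension.
\<close>

section \<open>The cubic B-spline and the runout basis\<close>

text \<open>The second moment of the cubic B-spline is \<open>1 / 3\<close>, so a spline with
  coefficients \<open>u (t\<^sub>k)\<close> would give \<open>u + h\<^sup>2 / 6 * u''\<close> to
  fourth order; the correction term in \<open>W\<close> cancels the excess. Differencing is forced:
  all weights have the same size \<open>h\<close>, so the diagonal weight of the undifferenced
  scheme does not dominate the others. Taking differences is the discrete form of differentiating a
  Volterra equation of the first kind into one of the second kind. The price is that the differenced
  residual must be \<open>O(h\<^sup>5)\<close> before the division by \<open>h\<close>. The runout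
  cell stands in the way, because quadratic extrapolation is accurate to third order only, and this
  is paid for with a fifth derivative of \<open>u\<close>. Hence the extension of \<open>u\<close>
  by zero must have five continuous derivatives, so the derivatives of \<open>u\<close> of orders
  \<open>0\<close> to \<open>5\<close> must vanish at \<open>0\<close>. That is read off the
  integral equation by Taylor expansion, with a remainder in the sixth derivative; this is where
  \<open>d \<ge> 6\<close> enters. The extension to the right of \<open>T\<close> is there because
  the stencils reach beyond \<open>t\<^sub>n\<close>.\<close>

lemma centred_cubic_truncated_powers:
  "centred_cubic t = (max 0 (t + 2) ^ 3 - 4 * max 0 (t + 1) ^ 3 + 6 * max 0 t ^ 3
     - 4 * max 0 (t - 1) ^ 3 + max 0 (t - 2) ^ 3) / 6"
  unfolding centred_cubic_def
  by (simp add: numeral_3_eq_3 max_def) (auto simp: field_simps)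

lemma continuous_on_centred_cubic [continuous_intros]:
  "continuous_on S f \<Longrightarrow> continuous_on S (\<lambda>x. centred_cubic (f x))"
  unfolding centred_cubic_truncated_powers by (intro continuous_intros) auto

text \<open>From \<open>2\<close> on, all five truncated powers are active and form a fourth
  difference, which annihilates cubics; up to \<open>-2\<close> none is active.\<close>

lemma centred_cubic_eq_0: "2 \<le> \<bar>t\<bar> \<Longrightarrow> centred_cubic t = 0"
  unfolding centred_cubic_truncated_powers
  by (auto simp: max_def abs_if power3_eq_cube split: if_splits) algebra+

text \<open>Only these four translates can be nonzero on a unit cell with local coordinate
  \<open>y\<close>; all spline sums below are reduced to them.\<close>

lemma centred_cubic_pieces:
  assumes "0 \<le> y" "y \<le> 1"
  shows "centred_cubic (y + 1) = (1 - y) ^ 3 / 6"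
    and "centred_cubic y = 2 / 3 - y ^ 2 + y ^ 3 / 2"
    and "centred_cubic (y - 1) = 1 / 6 + y / 2 + y ^ 2 / 2 - y ^ 3 / 2"
    and "centred_cubic (y - 2) = y ^ 3 / 6"
  using assms unfolding centred_cubic_truncated_powers
  by (auto simp: max_def power3_eq_cube power2_eq_square field_simps)

text \<open>The upper bound follows from nonnegativity, since the four translates on a cell add up
  to one.\<close>

lemma centred_cubic_bounds: "0 \<le> centred_cubic t" "centred_cubic t \<le> 1"
proof -
  have pc: "0 \<le> centred_cubic (y + 1) \<and> centred_cubic (y + 1) \<le> 1"
    "0 \<le> centred_cubic y \<and> centred_cubic y \<le> 1"
    "0 \<le> centred_cubic (y - 1) \<and> centred_cubic (y - 1) \<le> 1"
    "0 \<le> centred_cubic (y - 2) \<and> centred_cubic (y - 2) \<le> 1" if "0 \<le> y" "y \<le> 1" for y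
  proof -
    have *: "0 \<le> x ^ 3" "x ^ 3 \<le> x ^ 2" "0 \<le> x ^ 2" if "0 \<le> x" "x \<le> 1" for x :: real
      using that power_decreasing[of 2 3 x] by auto
    \<comment> \<open>Reflecting \<open>y\<close> to \<open>1 - y\<close> exchanges the two middle
      pieces, so the single estimate \<open>cubic\<close> serves both.\<close>
    have eq: "centred_cubic y = 1 / 6 + (1 - y) / 2 + (1 - y) ^ 2 / 2 - (1 - y) ^ 3 / 2"
      using that by (simp add: centred_cubic_pieces power2_eq_square power3_eq_cube field_simps)
    have cubic: "0 \<le> 1 / 6 + x / 2 + x ^ 2 / 2 - x ^ 3 / 2" if "0 \<le> x" "x \<le> 1" for x :: real
      using *[OF that] that by linarith
    have "0 \<le> centred_cubic (y + 1)" "0 \<le> centred_cubic (y - 2)"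
      using *[of y] *[of "1 - y"] that by (simp_all add: centred_cubic_pieces)
    moreover have "0 \<le> centred_cubic (y - 1)" "0 \<le> centred_cubic y"
      unfolding eq using cubic[of y] cubic[of "1 - y"] that by (simp_all add: centred_cubic_pieces)
    moreover have "centred_cubic (y + 1) + centred_cubic y + centred_cubic (y - 1)
        + centred_cubic (y - 2) = 1"
      unfolding centred_cubic_pieces[OF that] by (simp add: power2_eq_square power3_eq_cube field_simps)
    ultimately show "0 \<le> centred_cubic (y + 1) \<and> centred_cubic (y + 1) \<le> 1"
      "0 \<le> centred_cubic y \<and> centred_cubic y \<le> 1"
      "0 \<le> centred_cubic (y - 1) \<and> centred_cubic (y - 1) \<le> 1"
      "0 \<le> centred_cubic (y - 2) \<and> centred_cubic (y - 2) \<le> 1"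
      by linarith+
  qed
  consider "2 \<le> \<bar>t\<bar>" | "-2 \<le> t" "t \<le> -1" | "-1 \<le> t" "t \<le> 0" | "0 \<le> t" "t \<le> 1" | "1 \<le> t" "t \<le> 2"
    by linarith
  then have "0 \<le> centred_cubic t \<and> centred_cubic t \<le> 1"
  proof cases
    case 1 then show ?thesis by (simp add: centred_cubic_eq_0)
  next
    case 2 then show ?thesis using pc(4)[of "t + 2"] by simp
  next
    case 3 then show ?thesis using pc(3)[of "t + 1"] by simp
  next
    case 4 then show ?thesis using pc(2)[of t] by simp
  next
    case 5 then show ?thesis using pc(1)[of "t - 1"] by simp
  qed
  then show "0 \<le> centred_cubic t" "centred_cubic t \<le> 1" by auto
qed

lemma continuous_on_runout_basis [continuous_intros]:
  "continuous_on S f \<Longrightarrow> continuous_on S (\<lambda>x. runout_basis j (f x))"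
  unfolding runout_basis_def
  by (cases "j = 0"; cases "j = 1"; cases "j = 2") (auto intro!: continuous_intros)

lemma abs_runout_basis_le: "\<bar>runout_basis j x\<bar> \<le> 4"
  using centred_cubic_bounds[of x] centred_cubic_bounds[of "x + 1"] centred_cubic_bounds[of "x - 1"]
    centred_cubic_bounds[of "x - 2"] centred_cubic_bounds[of "x - real j"]
  unfolding runout_basis_def by auto

text \<open>The correction terms are multiples of the translate centred at \<open>-1\<close>, whose
  support ends at \<open>1\<close>.\<close>

lemma runout_basis_eq_centred_cubic: "1 \<le> x \<Longrightarrow> runout_basis j x = centred_cubic (x - real j)"
  unfolding runout_basis_def by (auto simp: centred_cubic_eq_0)

lemma runout_basis_eq_0: "real j + 2 \<le> x \<Longrightarrow> runout_basis j x = 0"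
  by (subst runout_basis_eq_centred_cubic) (auto simp: centred_cubic_eq_0)

text \<open>The hypothesis on \<open>c\<close> lets the stencil \<open>m - 1, ..., m + 2\<close> run
  past \<open>n\<close>, so the upper end of the sum is no special case.\<close>

lemma runout_sum_interior:
  assumes c: "\<And>j. j > n \<Longrightarrow> c j = 0" and m: "m \<ge> 1" and y: "0 \<le> y" "y \<le> 1"
  shows "(\<Sum>j=0..n. c j * runout_basis j (real m + y)) =
    c (m - 1) * centred_cubic (y + 1) + c m * centred_cubic y
    + c (m + 1) * centred_cubic (y - 1) + c (m + 2) * centred_cubic (y - 2)"
proof -
  have "(\<Sum>j=0..n. c j * runout_basis j (real m + y))
      = (\<Sum>j\<in>{0..n+m+2}. c j * centred_cubic (real m + y - real j))"
    using m y c
    by (intro sum.mono_neutral_cong_left) (auto simp: runout_basis_eq_centred_cubic)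
  also have "\<dots> = (\<Sum>j\<in>{m-1,m,m+1,m+2}. c j * centred_cubic (real m + y - real j))"
  proof (rule sum.mono_neutral_right)
    show "\<forall>j\<in>{0..n + m + 2} - {m - 1, m, m + 1, m + 2}. c j * centred_cubic (real m + y - real j) = 0"
    proof
      fix j assume "j \<in> {0..n + m + 2} - {m - 1, m, m + 1, m + 2}"
      then have "j + 2 \<le> m \<or> m + 3 \<le> j" by auto
      then have "2 \<le> \<bar>real m + y - real j\<bar>" using y by linarith
      then show "c j * centred_cubic (real m + y - real j) = 0" by (simp add: centred_cubic_eq_0)
    qed
  qed auto
  also have "\<dots> = c (m - 1) * centred_cubic (y + 1) + c m * centred_cubic y
    + c (m + 1) * centred_cubic (y - 1) + c (m + 2) * centred_cubic (y - 2)"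
    using m by (cases m) (auto simp: algebra_simps)
  finally show ?thesis .
qed

text \<open>Regrouped by translates, the one centred at \<open>-1\<close> carries
  \<open>3 * c 0 - 3 * c 1 + c 2\<close>, the quadratic extrapolation of the coefficients to index
  \<open>-1\<close>. This is the parabolic runout condition.\<close>

lemma runout_sum_first:
  assumes c: "\<And>j. j > n \<Longrightarrow> c j = 0" and y: "0 \<le> y" "y \<le> 1"
  shows "(\<Sum>j=0..n. c j * runout_basis j y) =
    c 0 * (centred_cubic y + 3 * centred_cubic (y + 1))
    + c 1 * (centred_cubic (y - 1) - 3 * centred_cubic (y + 1))
    + c 2 * (centred_cubic (y - 2) + centred_cubic (y + 1))"
proof -
  have "(\<Sum>j=0..n. c j * runout_basis j y) = (\<Sum>j\<in>{0..n+2}. c j * runout_basis j y)"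
    using c by (intro sum.mono_neutral_left) auto
  also have "\<dots> = (\<Sum>j\<in>{0,1,2}. c j * runout_basis j y)"
  proof (rule sum.mono_neutral_right)
    show "\<forall>j\<in>{0..n + 2} - {0, 1, 2}. c j * runout_basis j y = 0"
      using y by (auto simp: runout_basis_def centred_cubic_eq_0)
  qed auto
  also have "\<dots> = c 0 * (centred_cubic y + 3 * centred_cubic (y + 1))
    + c 1 * (centred_cubic (y - 1) - 3 * centred_cubic (y + 1))
    + c 2 * (centred_cubic (y - 2) + centred_cubic (y + 1))"
    by (simp add: runout_basis_def)
  finally show ?thesis .
qed

text \<open>The factor \<open>4\<close> counts the plain translates that meet at a point beyond the
  runout cell, each with values between \<open>0\<close> and \<open>1\<close>.\<close>

lemma runout_sum_bound:
  assumes c: "\<And>j. j > n \<Longrightarrow> c j = 0" and E: "\<And>j. \<bar>c j\<bar> \<le> E" and x: "1 \<le> x"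
  shows "\<bar>\<Sum>j=0..n. c j * runout_basis j x\<bar> \<le> 4 * E"
proof -
  define m where "m = nat \<lfloor>x\<rfloor>"
  define y where "y = x - real m"
  have m: "m \<ge> 1" and y: "0 \<le> y" "y \<le> 1" and x_eq: "x = real m + y"
    using x unfolding y_def m_def by linarith+
  have "\<bar>c j * centred_cubic z\<bar> \<le> E" for j z
    using mult_mono[OF E[of j], of "centred_cubic z" 1] centred_cubic_bounds[of z] order_trans[OF abs_ge_zero E]
    by (simp add: abs_mult)
  from this[of "m - 1" "y + 1"] this[of m y] this[of "m + 1" "y - 1"] this[of "m + 2" "y - 2"]
  show ?thesis using runout_sum_interior[of n c, OF c m y] unfolding x_eq by linarith
qed

section \<open>Smooth extensions and Taylor bounds\<close>

text \<open>Only the derivative of order \<open>k\<close> is extended, by its endpoint values, and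
  the lower ones are recovered by integration. Passing a whole family \<open>f\<close> lets the
  induction drop its first member. The constant value on the left is recorded because the extension
  vanishes there if all given derivatives vanish at \<open>0\<close>.\<close>

lemma smooth_extension:
  fixes f :: "nat \<Rightarrow> real \<Rightarrow> real"
  assumes "T > 0"
    and "\<And>p x. p < k \<Longrightarrow> x \<in> {0..T} \<Longrightarrow>
      (f p has_vector_derivative f (Suc p) x) (at x within {0..T})"
    and "continuous_on {0..T} (f k)"
  shows "\<exists>V M. (\<forall>p<k. \<forall>x. (V p has_real_derivative V (Suc p) x) (at x)) \<and>
    (\<forall>p\<le>k. \<forall>x\<in>{0..T}. V p x = f p x) \<and> (\<forall>p\<le>k. continuous_on UNIV (V p)) \<and>
    (\<forall>x\<le>0. V k x = f k 0) \<and> (\<forall>x. \<bar>V k x\<bar> \<le> (M::real))"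
  using assms(2,3)
proof (induction k arbitrary: f)
  case 0
  define V where "V = (\<lambda>p::nat. \<lambda>x. f p (max 0 (min T x)))"
  have clamp: "max 0 (min T x) \<in> {0..T}" for x using \<open>T > 0\<close> by auto
  have "continuous_on UNIV (V 0)"
    unfolding V_def using 0(2) clamp
    by (intro continuous_on_compose2[OF 0(2)] continuous_intros) auto
  moreover obtain M where "\<And>x. x \<in> {0..T} \<Longrightarrow> \<bar>f 0 x\<bar> \<le> M"
    using compact_imp_bounded[OF compact_continuous_image[OF 0(2) compact_Icc]]
    unfolding bounded_iff real_norm_def by blast
  ultimately show ?case using clamp \<open>T > 0\<close>
    by (intro exI[of _ V] exI[of _ M]) (auto simp: V_def)
next
  case (Suc k)
  have "\<exists>V M. (\<forall>p<k. \<forall>x. (V p has_real_derivative V (Suc p) x) (at x)) \<and>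
    (\<forall>p\<le>k. \<forall>x\<in>{0..T}. V p x = f (Suc p) x) \<and> (\<forall>p\<le>k. continuous_on UNIV (V p)) \<and>
    (\<forall>x\<le>0. V k x = f (Suc k) 0) \<and> (\<forall>x. \<bar>V k x\<bar> \<le> (M::real))"
    using Suc.prems by (intro Suc.IH[of "\<lambda>p. f (Suc p)"]) auto
  then obtain V M where *: "\<forall>p<k. \<forall>x. (V p has_real_derivative V (Suc p) x) (at x)"
    "\<forall>p\<le>k. \<forall>x\<in>{0..T}. V p x = f (Suc p) x" "\<forall>p\<le>k. continuous_on UNIV (V p)"
    "\<forall>x\<le>0. V k x = f (Suc k) 0" "\<forall>x. \<bar>V k x\<bar> \<le> M" by (elim exE conjE)
  note V = *[rule_format]
  have "\<And>x. isCont (V 0) x"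
    using V(3)[of 0] by (simp add: continuous_on_eq_continuous_at)
  then obtain F where F: "\<And>x. (F has_vector_derivative V 0 x) (at x)"
    using einterval_antiderivative[of "-\<infinity>" "\<infinity>" "V 0"] by auto
  \<comment> \<open>The constant of integration makes \<open>G\<close> agree with \<open>f 0\<close>
    at \<open>0\<close>; equal derivatives then give agreement on the whole interval.\<close>
  define G where "G = (\<lambda>x. F x - F 0 + f 0 0)"
  have G: "(G has_real_derivative V 0 x) (at x)" for x
    unfolding G_def using F[of x]
    by (auto simp: has_real_derivative_iff_has_vector_derivative intro!: derivative_eq_intros)
  have "((\<lambda>x. G x - f 0 x) has_real_derivative 0) (at x within {0..T})" if "x \<in> {0..T}" for x
  proof -
    have "(f 0 has_real_derivative V 0 x) (at x within {0..T})"
      using Suc.prems(1)[of 0 x] V(2)[of 0 x] that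
      by (simp add: has_real_derivative_iff_has_vector_derivative)
    from DERIV_diff[OF has_field_derivative_at_within[OF G] this] show ?thesis by simp
  qed
  then obtain c where c: "\<And>x. x \<in> {0..T} \<Longrightarrow> G x - f 0 x = c"
    using has_field_derivative_zero_constant[of "{0..T}" "\<lambda>x. G x - f 0 x"] by auto
  have "c = 0" using c[of 0] \<open>T > 0\<close> by (simp add: G_def)
  then have Gf: "G x = f 0 x" if "x \<in> {0..T}" for x using c[OF that] by simp
  have "continuous_on UNIV G"
    using G by (meson DERIV_isCont continuous_at_imp_continuous_on)
  define W where "W = (\<lambda>p. case p of 0 \<Rightarrow> G | Suc q \<Rightarrow> V q)"
  have "(W p has_real_derivative W (Suc p) x) (at x)" if "p < Suc k" for p x
    using that V(1)[of "p - 1" x] G[of x] by (cases p) (auto simp: W_def)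
  moreover have "W p x = f p x" if "p \<le> Suc k" "x \<in> {0..T}" for p x
    using that V(2)[of "p - 1" x] Gf[of x] by (cases p) (auto simp: W_def)
  moreover have "continuous_on UNIV (W p)" if "p \<le> Suc k" for p
    using that V(3)[of "p - 1"] \<open>continuous_on UNIV G\<close> by (cases p) (auto simp: W_def)
  moreover have "W (Suc k) = V k" by (simp add: W_def)
  ultimately show ?case
    using V(4,5) by (intro exI[of _ W] exI[of _ M]) simp
qed

lemma C_on_smooth_extension:
  assumes "T > 0" "C_on d {0..T} f" "k \<le> d"
  obtains V M where "\<And>p x. p < k \<Longrightarrow> (V p has_real_derivative V (Suc p) x) (at x)"
    "\<And>p x. p \<le> k \<Longrightarrow> x \<in> {0..T} \<Longrightarrow> V p x = nth_deriv_within {0..T} p f x"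
    "\<And>p. p \<le> k \<Longrightarrow> continuous_on UNIV (V p)"
    "\<And>x. x \<le> 0 \<Longrightarrow> V k x = nth_deriv_within {0..T} k f 0" "\<And>x. \<bar>V k x\<bar> \<le> (M::real)"
proof -
  have diff: "nth_deriv_within {0..T} p f differentiable_on {0..T}" if "p < d" for p
    using assms that by (auto simp: C_on_def)
  have "(nth_deriv_within {0..T} p f has_vector_derivative nth_deriv_within {0..T} (Suc p) f x)
      (at x within {0..T})" if "p < k" "x \<in> {0..T}" for p x
    using diff[of p] that \<open>k \<le> d\<close> by (auto simp: differentiable_on_def vector_derivative_works)
  moreover have "continuous_on {0..T} (nth_deriv_within {0..T} k f)"
    using assms diff[THEN differentiable_imp_continuous_on, of k]
    by (cases "k = d") (auto simp: C_on_def)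
  ultimately obtain V M where "\<forall>p<k. \<forall>x. (V p has_real_derivative V (Suc p) x) (at x)"
    "\<forall>p\<le>k. \<forall>x\<in>{0..T}. V p x = nth_deriv_within {0..T} p f x"
    "\<forall>p\<le>k. continuous_on UNIV (V p)"
    "\<forall>x\<le>0. V k x = nth_deriv_within {0..T} k f 0" "\<forall>x. \<bar>V k x\<bar> \<le> (M::real)"
    using smooth_extension[OF \<open>T > 0\<close>, of k "\<lambda>p. nth_deriv_within {0..T} p f"]
    by (elim meta_impE) auto
  from this[rule_format] show ?thesis by (rule that)
qed

lemma taylor_remainder_bound:
  fixes F :: "nat \<Rightarrow> real \<Rightarrow> real"
  assumes "\<And>p y. p < n \<Longrightarrow> (F p has_real_derivative F (Suc p) y) (at y)"
    and "\<And>y. \<bar>y - x\<bar> \<le> \<bar>r\<bar> \<Longrightarrow> \<bar>F n y\<bar> \<le> M"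
  shows "\<bar>F 0 (x + r) - (\<Sum>m<n. F m x / fact m * r ^ m)\<bar> \<le> M / fact n * \<bar>r\<bar> ^ n"
proof -
  have "((\<lambda>r. F p (x + r)) has_real_derivative F (Suc p) (x + y)) (at y)" if "p < n" for p y
    using DERIV_shift[of "F p" "F (Suc p) (x + y)" y x] assms(1)[OF that, of "x + y"]
    by (simp add: add.commute)
  then obtain t where t: "\<bar>t\<bar> \<le> \<bar>r\<bar>"
    "F 0 (x + r) = (\<Sum>m<n. F m (x + 0) / fact m * r ^ m) + F n (x + t) / fact n * r ^ n"
    using Maclaurin_bi_le[of "\<lambda>p r. F p (x + r)" "\<lambda>r. F 0 (x + r)" n r] by auto
  have "\<bar>F n (x + t)\<bar> \<le> M" using t by (intro assms(2)) auto
  then have "\<bar>F n (x + t)\<bar> / fact n * \<bar>r\<bar> ^ n \<le> M / fact n * \<bar>r\<bar> ^ n"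
    by (intro mult_right_mono divide_right_mono) auto
  then show ?thesis using t(2) by (simp add: abs_mult power_abs)
qed

text \<open>Downward induction on the order: once \<open>V (Suc q)\<close> is zero on the negative
  half-line, \<open>V q\<close> is constant there, and the constant is
  \<open>V q 0 = 0\<close>.\<close>

lemma vanishing_extension:
  fixes V :: "nat \<Rightarrow> real \<Rightarrow> real"
  assumes der: "\<And>p x. p < k \<Longrightarrow> (V p has_real_derivative V (Suc p) x) (at x)"
    and top: "\<And>x. x \<le> 0 \<Longrightarrow> V k x = 0" and zero: "\<And>p. p \<le> k \<Longrightarrow> V p 0 = 0"
    and "p \<le> k" "x \<le> 0"
  shows "V p x = 0"
  using \<open>p \<le> k\<close> \<open>x \<le> 0\<close>
proof (induction arbitrary: x rule: inc_induct)
  case base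
  then show ?case by (rule top)
next
  case (step q)
  have "\<exists>c. \<forall>y\<in>{..0}. V q y = c"
    using der[of q] step by (intro has_field_derivative_zero_constant)
      (auto, metis has_field_derivative_at_within)
  then show ?case using zero[of q] step by force
qed

section \<open>Quasi-interpolation\<close>

text \<open>\<open>F\<close> is a family of successive derivatives, so that the same map applies to
  the solution and to its backward difference.\<close>

definition spline_coeff :: "real \<Rightarrow> (nat \<Rightarrow> real \<Rightarrow> real) \<Rightarrow> real \<Rightarrow> real" where
  "spline_coeff h F x = F 0 x - h ^ 2 / 6 * F 2 x"

text \<open>The nodes that matter lie within two steps of \<open>x\<close>, hence
  \<open>2 * h\<close>. The remainder of \<open>F 0\<close> contributes \<open>2 / 3\<close> of the
  bound, that of the correction term \<open>1 / 3\<close>.\<close>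

lemma spline_coeff_taylor4:
  assumes der: "\<And>p x. p < 4 \<Longrightarrow> (F p has_real_derivative F (Suc p) x) (at x)"
    and M: "\<And>y. \<bar>y - x\<bar> \<le> 2 * h \<Longrightarrow> \<bar>F 4 y\<bar> \<le> M" and r: "\<bar>r\<bar> \<le> 2 * h"
  shows "\<bar>spline_coeff h F (x + r) - (F 0 x + F 1 x * r + F 2 x * r ^ 2 / 2 + F 3 x * r ^ 3 / 6
    - h ^ 2 / 6 * (F 2 x + F 3 x * r))\<bar> \<le> M * h ^ 4"
proof -
  have h: "0 \<le> h" using r by auto
  then have "0 \<le> M" using order_trans[OF abs_ge_zero M[of x]] by simp
  have "\<bar>F 0 (x + r) - (F 0 x + F 1 x * r + F 2 x * r ^ 2 / 2 + F 3 x * r ^ 3 / 6)\<bar>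
      \<le> M / 24 * \<bar>r\<bar> ^ 4"
    using taylor_remainder_bound[of 4 F x r M] der M r
    by (simp add: eval_nat_numeral fact_numeral algebra_simps)
  also have "\<dots> \<le> M / 24 * (2 * h) ^ 4"
    using r \<open>0 \<le> M\<close> by (intro mult_left_mono power_mono) auto
  finally have 1: "\<bar>F 0 (x + r) - (F 0 x + F 1 x * r + F 2 x * r ^ 2 / 2 + F 3 x * r ^ 3 / 6)\<bar>
    \<le> 2 / 3 * (M * h ^ 4)" by (simp add: power_mult_distrib)
  have "\<bar>F 2 (x + r) - (F 2 x + F 3 x * r)\<bar> \<le> M / 2 * \<bar>r\<bar> ^ 2"
  proof -
    have "(F (p + 2) has_real_derivative F (Suc p + 2) y) (at y)" if "p < 2" for p y
      using der[of "p + 2" y] that by simp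
    from taylor_remainder_bound[of 2 "\<lambda>p. F (p + 2)" x r M, OF this] show ?thesis
      using M r by (simp add: eval_nat_numeral algebra_simps)
  qed
  also have "\<dots> \<le> M / 2 * (2 * h) ^ 2"
    using r \<open>0 \<le> M\<close> by (intro mult_left_mono power_mono) auto
  finally have "h ^ 2 / 6 * \<bar>F 2 (x + r) - (F 2 x + F 3 x * r)\<bar> \<le> h ^ 2 / 6 * (M / 2 * (2 * h) ^ 2)"
    by (intro mult_left_mono) auto
  also have "\<dots> = 1 / 3 * (M * h ^ 4)" by (simp add: power2_eq_square power4_eq_xxxx)
  finally have 2: "\<bar>h ^ 2 / 6 * (F 2 (x + r) - (F 2 x + F 3 x * r))\<bar> \<le> 1 / 3 * (M * h ^ 4)"
    by (simp add: abs_mult)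
  have "spline_coeff h F (x + r) - (F 0 x + F 1 x * r + F 2 x * r ^ 2 / 2 + F 3 x * r ^ 3 / 6
      - h ^ 2 / 6 * (F 2 x + F 3 x * r))
    = (F 0 (x + r) - (F 0 x + F 1 x * r + F 2 x * r ^ 2 / 2 + F 3 x * r ^ 3 / 6))
      - h ^ 2 / 6 * (F 2 (x + r) - (F 2 x + F 3 x * r))"
    by (simp add: spline_coeff_def algebra_simps)
  then show ?thesis using 1 2 by linarith
qed

text \<open>The quadratic analogue, for the runout cell; the two remainders have shares
  \<open>4 / 3\<close> and \<open>1 / 3\<close>.\<close>

lemma spline_coeff_taylor3:
  assumes der: "\<And>p x. p < 3 \<Longrightarrow> (F p has_real_derivative F (Suc p) x) (at x)"
    and M: "\<And>y. \<bar>y - x\<bar> \<le> 2 * h \<Longrightarrow> \<bar>F 3 y\<bar> \<le> M" and r: "\<bar>r\<bar> \<le> 2 * h"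
  shows "\<bar>spline_coeff h F (x + r) - (F 0 x + F 1 x * r + F 2 x * r ^ 2 / 2 - h ^ 2 / 6 * F 2 x)\<bar>
    \<le> 5 / 3 * (M * h ^ 3)"
proof -
  have h: "0 \<le> h" using r by auto
  then have "0 \<le> M" using order_trans[OF abs_ge_zero M[of x]] by simp
  have "\<bar>F 0 (x + r) - (F 0 x + F 1 x * r + F 2 x * r ^ 2 / 2)\<bar> \<le> M / 6 * \<bar>r\<bar> ^ 3"
    using taylor_remainder_bound[of 3 F x r M] der M r
    by (simp add: eval_nat_numeral fact_numeral algebra_simps)
  also have "\<dots> \<le> M / 6 * (2 * h) ^ 3"
    using r \<open>0 \<le> M\<close> by (intro mult_left_mono power_mono) auto
  finally have 1: "\<bar>F 0 (x + r) - (F 0 x + F 1 x * r + F 2 x * r ^ 2 / 2)\<bar> \<le> 4 / 3 * (M * h ^ 3)"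
    by (simp add: power_mult_distrib)
  have "\<bar>F 2 (x + r) - F 2 x\<bar> \<le> M * \<bar>r\<bar>"
    using taylor_remainder_bound[of 1 "\<lambda>p. F (p + 2)" x r M] der[of 2] M r
    by (simp add: eval_nat_numeral)
  also have "\<dots> \<le> M * (2 * h)"
    using r \<open>0 \<le> M\<close> by (intro mult_left_mono) auto
  finally have "h ^ 2 / 6 * \<bar>F 2 (x + r) - F 2 x\<bar> \<le> h ^ 2 / 6 * (M * (2 * h))"
    by (intro mult_left_mono) auto
  also have "\<dots> = 1 / 3 * (M * h ^ 3)" by (simp add: power2_eq_square power3_eq_cube)
  finally have 2: "\<bar>h ^ 2 / 6 * (F 2 (x + r) - F 2 x)\<bar> \<le> 1 / 3 * (M * h ^ 3)"
    by (simp add: abs_mult)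
  have "spline_coeff h F (x + r) - (F 0 x + F 1 x * r + F 2 x * r ^ 2 / 2 - h ^ 2 / 6 * F 2 x)
    = (F 0 (x + r) - (F 0 x + F 1 x * r + F 2 x * r ^ 2 / 2)) - h ^ 2 / 6 * (F 2 (x + r) - F 2 x)"
    by (simp add: spline_coeff_def algebra_simps)
  then show ?thesis using 1 2 by linarith
qed

text \<open>Up to order three the discrete moments over the neighbouring nodes do not depend on
  \<open>y\<close>. They are the moments of the B-spline as a density: that of four independent
  uniform variables on a unit interval, summed and centred, with variance
  \<open>4 / 12\<close>.\<close>

lemma centred_cubic_moments:
  assumes "0 \<le> y" "y \<le> 1"
  shows "centred_cubic (y + 1) + centred_cubic y + centred_cubic (y - 1) + centred_cubic (y - 2) = 1"
    and "(y + 1) * centred_cubic (y + 1) + y * centred_cubic y + (y - 1) * centred_cubic (y - 1)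
      + (y - 2) * centred_cubic (y - 2) = 0"
    and "(y + 1) ^ 2 * centred_cubic (y + 1) + y ^ 2 * centred_cubic y
      + (y - 1) ^ 2 * centred_cubic (y - 1) + (y - 2) ^ 2 * centred_cubic (y - 2) = 1 / 3"
    and "(y + 1) ^ 3 * centred_cubic (y + 1) + y ^ 3 * centred_cubic y
      + (y - 1) ^ 3 * centred_cubic (y - 1) + (y - 2) ^ 3 * centred_cubic (y - 2) = 0"
  unfolding centred_cubic_pieces[OF assms]
  by (simp_all add: power2_eq_square power3_eq_cube field_simps)

lemma quasi_interpolation_interior:
  assumes der: "\<And>p x. p < 4 \<Longrightarrow> (F p has_real_derivative F (Suc p) x) (at x)"
    and M: "\<And>y. \<bar>y - x\<bar> \<le> 2 * h \<Longrightarrow> \<bar>F 4 y\<bar> \<le> M" and h: "0 \<le> h" and y: "0 \<le> y" "y \<le> 1"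
  defines "W \<equiv> spline_coeff h F"
  shows "\<bar>W (x + (y + 1) * h) * centred_cubic (y + 1) + W (x + y * h) * centred_cubic y
    + W (x + (y - 1) * h) * centred_cubic (y - 1) + W (x + (y - 2) * h) * centred_cubic (y - 2)
    - F 0 x\<bar> \<le> M * h ^ 4"
proof -
  \<comment> \<open>\<open>P\<close> is the spline coefficient of the cubic Taylor polynomial of
    \<open>F 0\<close> at \<open>x\<close>. The spline reproduces that polynomial at
    \<open>x\<close>, so only the remainder \<open>e\<close> contributes.\<close>
  define P where "P = (\<lambda>r. F 0 x + F 1 x * r + F 2 x * r ^ 2 / 2 + F 3 x * r ^ 3 / 6
    - h ^ 2 / 6 * (F 2 x + F 3 x * r))"
  define e where "e = (\<lambda>z. W (x + z * h) - P (z * h))"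
  have e: "\<bar>e z * centred_cubic z\<bar> \<le> M * h ^ 4 * centred_cubic z" if "\<bar>z\<bar> \<le> 2" for z
  proof -
    have "\<bar>z * h\<bar> \<le> 2 * h" using that h by (simp add: abs_mult mult_right_mono)
    from spline_coeff_taylor4[OF der M this] have "\<bar>e z\<bar> \<le> M * h ^ 4"
      by (simp add: e_def W_def P_def)
    then show ?thesis using centred_cubic_bounds[of z] by (simp add: abs_mult mult_right_mono)
  qed
  \<comment> \<open>The second moment produces \<open>h ^ 2 / 6 * F 2 x\<close>, exactly what the
    constant term of \<open>P\<close> subtracts; the first and third moments vanish.\<close>
  have P: "P ((y + 1) * h) * centred_cubic (y + 1) + P (y * h) * centred_cubic y
    + P ((y - 1) * h) * centred_cubic (y - 1) + P ((y - 2) * h) * centred_cubic (y - 2) = F 0 x"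
  proof -
    have *: "P (z * h) * b = (F 0 x - h ^ 2 / 6 * F 2 x) * b + (F 1 x * h - h ^ 3 / 6 * F 3 x) * (z * b)
      + F 2 x * h ^ 2 / 2 * (z ^ 2 * b) + F 3 x * h ^ 3 / 6 * (z ^ 3 * b)" for z b
      unfolding P_def by (simp add: field_simps power2_eq_square power3_eq_cube)
    have sum: "(a * b0 + c * (z0 * b0) + d * (z0 ^ 2 * b0) + e * (z0 ^ 3 * b0))
      + (a * b1 + c * (z1 * b1) + d * (z1 ^ 2 * b1) + e * (z1 ^ 3 * b1))
      + (a * b2 + c * (z2 * b2) + d * (z2 ^ 2 * b2) + e * (z2 ^ 3 * b2))
      + (a * b3 + c * (z3 * b3) + d * (z3 ^ 2 * b3) + e * (z3 ^ 3 * b3))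
      = a * (b0 + b1 + b2 + b3) + c * (z0 * b0 + z1 * b1 + z2 * b2 + z3 * b3)
      + d * (z0 ^ 2 * b0 + z1 ^ 2 * b1 + z2 ^ 2 * b2 + z3 ^ 2 * b3)
      + e * (z0 ^ 3 * b0 + z1 ^ 3 * b1 + z2 ^ 3 * b2 + z3 ^ 3 * b3)"
      for a c d e b0 b1 b2 b3 z0 z1 z2 z3 :: real
      by (simp only: distrib_left ac_simps)
    show ?thesis unfolding * sum centred_cubic_moments[OF y] by simp
  qed
  have "\<bar>W (x + (y + 1) * h) * centred_cubic (y + 1) + W (x + y * h) * centred_cubic y
    + W (x + (y - 1) * h) * centred_cubic (y - 1) + W (x + (y - 2) * h) * centred_cubic (y - 2)
    - F 0 x\<bar> = \<bar>e (y + 1) * centred_cubic (y + 1) + e y * centred_cubic y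
    + e (y - 1) * centred_cubic (y - 1) + e (y - 2) * centred_cubic (y - 2)\<bar>"
    unfolding P[symmetric] e_def left_diff_distrib by (simp only: algebra_simps)
  also have "\<dots> \<le> M * h ^ 4 * centred_cubic (y + 1) + M * h ^ 4 * centred_cubic y
    + M * h ^ 4 * centred_cubic (y - 1) + M * h ^ 4 * centred_cubic (y - 2)"
  proof -
    have "\<bar>e (y + 1) * centred_cubic (y + 1)\<bar> \<le> M * h ^ 4 * centred_cubic (y + 1)"
      "\<bar>e y * centred_cubic y\<bar> \<le> M * h ^ 4 * centred_cubic y"
      "\<bar>e (y - 1) * centred_cubic (y - 1)\<bar> \<le> M * h ^ 4 * centred_cubic (y - 1)"
      "\<bar>e (y - 2) * centred_cubic (y - 2)\<bar> \<le> M * h ^ 4 * centred_cubic (y - 2)"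
      by (rule e, use y in simp)+
    then show ?thesis by linarith
  qed
  \<comment> \<open>The node errors are averaged with nonnegative weights of sum one, so no constant
    is lost.\<close>
  also have "\<dots> = M * h ^ 4"
    unfolding distrib_left[symmetric] centred_cubic_moments(1)[OF y] by simp
  finally show ?thesis .
qed

text \<open>Extrapolation to the missing node is exact for quadratics only, which costs one order.
  The constant \<open>20\<close> is three terms, times the bound \<open>4\<close> on a basis
  function, times \<open>5 / 3\<close> for a coefficient.\<close>

lemma quasi_interpolation_runout:
  assumes der: "\<And>p x. p < 3 \<Longrightarrow> (F p has_real_derivative F (Suc p) x) (at x)"
    and M: "\<And>y. \<bar>y - x\<bar> \<le> 2 * h \<Longrightarrow> \<bar>F 3 y\<bar> \<le> M" and h: "0 \<le> h" and y: "0 \<le> y" "y \<le> 1"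
  defines "W \<equiv> spline_coeff h F"
  shows "\<bar>W (x + y * h) * (centred_cubic y + 3 * centred_cubic (y + 1))
    + W (x + (y - 1) * h) * (centred_cubic (y - 1) - 3 * centred_cubic (y + 1))
    + W (x + (y - 2) * h) * (centred_cubic (y - 2) + centred_cubic (y + 1))
    - F 0 x\<bar> \<le> 20 * M * h ^ 3"
proof -
  define P where "P = (\<lambda>r. F 0 x + F 1 x * r + F 2 x * r ^ 2 / 2 - h ^ 2 / 6 * F 2 x)"
  define e where "e = (\<lambda>z. W (x + z * h) - P (z * h))"
  have "0 \<le> M" using order_trans[OF abs_ge_zero M[of x]] h by simp
  have e: "\<bar>e z * b\<bar> \<le> 5 / 3 * (M * h ^ 3) * 4" if "\<bar>z\<bar> \<le> 2" "\<bar>b\<bar> \<le> 4" for z b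
  proof -
    have "\<bar>z * h\<bar> \<le> 2 * h" using that h by (simp add: abs_mult mult_right_mono)
    from spline_coeff_taylor3[OF der M this] have "\<bar>e z\<bar> \<le> 5 / 3 * (M * h ^ 3)"
      by (simp add: e_def W_def P_def)
    then show ?thesis using that(2) unfolding abs_mult by (intro mult_mono) auto
  qed
  have P: "P (y * h) * (centred_cubic y + 3 * centred_cubic (y + 1))
    + P ((y - 1) * h) * (centred_cubic (y - 1) - 3 * centred_cubic (y + 1))
    + P ((y - 2) * h) * (centred_cubic (y - 2) + centred_cubic (y + 1)) = F 0 x"
  proof -
    have *: "P (z * h) * b = (F 0 x - h ^ 2 / 6 * F 2 x) * b + F 1 x * h * (z * b)
      + F 2 x * h ^ 2 / 2 * (z ^ 2 * b)" for z b
      unfolding P_def by (simp add: field_simps power2_eq_square)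
    \<comment> \<open>The identity
      \<open>3 * y ^ 2 - 3 * (y - 1) ^ 2 + (y - 2) ^ 2 = (y + 1) ^ 2\<close> and its analogues of
      lower degree restore the missing node, so the ordinary moments apply.\<close>
    have sum: "(a * (b1 + 3 * b0) + c * (y * (b1 + 3 * b0)) + d * (y ^ 2 * (b1 + 3 * b0)))
      + (a * (b2 - 3 * b0) + c * ((y - 1) * (b2 - 3 * b0)) + d * ((y - 1) ^ 2 * (b2 - 3 * b0)))
      + (a * (b3 + b0) + c * ((y - 2) * (b3 + b0)) + d * ((y - 2) ^ 2 * (b3 + b0)))
      = a * (b0 + b1 + b2 + b3)
      + c * ((y + 1) * b0 + y * b1 + (y - 1) * b2 + (y - 2) * b3)
      + d * ((y + 1) ^ 2 * b0 + y ^ 2 * b1 + (y - 1) ^ 2 * b2 + (y - 2) ^ 2 * b3)"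
      for a c d b0 b1 b2 b3 :: real
      by (simp add: algebra_simps power2_eq_square)
    show ?thesis unfolding * sum centred_cubic_moments[OF y] by simp
  qed
  have b: "\<bar>centred_cubic y + 3 * centred_cubic (y + 1)\<bar> \<le> 4"
    "\<bar>centred_cubic (y - 1) - 3 * centred_cubic (y + 1)\<bar> \<le> 4"
    "\<bar>centred_cubic (y - 2) + centred_cubic (y + 1)\<bar> \<le> 4"
    using centred_cubic_bounds[of "y + 1"] centred_cubic_bounds[of y]
      centred_cubic_bounds[of "y - 1"] centred_cubic_bounds[of "y - 2"] by linarith+
  have "\<bar>W (x + y * h) * (centred_cubic y + 3 * centred_cubic (y + 1))
    + W (x + (y - 1) * h) * (centred_cubic (y - 1) - 3 * centred_cubic (y + 1))
    + W (x + (y - 2) * h) * (centred_cubic (y - 2) + centred_cubic (y + 1)) - F 0 x\<bar>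
    = \<bar>e y * (centred_cubic y + 3 * centred_cubic (y + 1))
    + e (y - 1) * (centred_cubic (y - 1) - 3 * centred_cubic (y + 1))
    + e (y - 2) * (centred_cubic (y - 2) + centred_cubic (y + 1))\<bar>"
    unfolding P[symmetric] e_def left_diff_distrib by (simp only: algebra_simps)
  also have "\<dots> \<le> 3 * (5 / 3 * (M * h ^ 3) * 4)"
    using e[OF _ b(1), of y] e[OF _ b(2), of "y - 1"] e[OF _ b(3), of "y - 2"] y by linarith
  finally show ?thesis by simp
qed

text \<open>Here \<open>t\<close> runs backwards from the time \<open>n * h\<close>, so the runout
  cell is the latest time step. Vanishing to the left of \<open>0\<close> makes the coefficients
  beyond index \<open>n\<close> zero, as the stencil formulas demand.\<close>

lemma spline_approximation_error:
  fixes F :: "nat \<Rightarrow> real \<Rightarrow> real" and n :: nat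
  assumes der: "\<And>p x. p < 4 \<Longrightarrow> (F p has_real_derivative F (Suc p) x) (at x)"
    and M3: "\<And>x. x \<le> real n * h + 2 * h \<Longrightarrow> \<bar>F 3 x\<bar> \<le> M3"
    and M4: "\<And>x. x \<le> real n * h + 2 * h \<Longrightarrow> \<bar>F 4 x\<bar> \<le> M4"
    and zero: "\<And>x. x \<le> 0 \<Longrightarrow> F 0 x = 0" "\<And>x. x \<le> 0 \<Longrightarrow> F 2 x = 0"
    and h: "0 < h" and t: "0 \<le> t"
  defines "S \<equiv> \<Sum>j=0..n. spline_coeff h F (real n * h - real j * h) * runout_basis j (t / h)"
  shows "t \<le> h \<Longrightarrow> \<bar>S - F 0 (real n * h - t)\<bar> \<le> 20 * M3 * h ^ 3"
    and "h \<le> t \<Longrightarrow> \<bar>S - F 0 (real n * h - t)\<bar> \<le> M4 * h ^ 4"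
proof -
  define c where "c = (\<lambda>j. spline_coeff h F (real n * h - real j * h))"
  have c: "c j = 0" if "j > n" for j
  proof -
    have "real n * h \<le> real j * h" using that h by (intro mult_right_mono) auto
    then show ?thesis using zero by (simp add: c_def spline_coeff_def)
  qed
  define x where "x = real n * h - t"
  {
    assume "t \<le> h"
    define y where "y = t / h"
    have y: "0 \<le> y" "y \<le> 1" "t = y * h" using h t \<open>t \<le> h\<close> by (auto simp: y_def)
    have cs: "c 0 = spline_coeff h F (x + y * h)" "c 1 = spline_coeff h F (x + (y - 1) * h)"
      "c 2 = spline_coeff h F (x + (y - 2) * h)"
      by (simp_all add: c_def x_def y(3) algebra_simps)
    have "S = (\<Sum>j=0..n. c j * runout_basis j y)" by (simp add: S_def c_def y_def)
    also note runout_sum_first[of n c, OF c y(1,2)]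
    finally have S: "S = c 0 * (centred_cubic y + 3 * centred_cubic (y + 1))
      + c 1 * (centred_cubic (y - 1) - 3 * centred_cubic (y + 1))
      + c 2 * (centred_cubic (y - 2) + centred_cubic (y + 1))" .
    show "\<bar>S - F 0 (real n * h - t)\<bar> \<le> 20 * M3 * h ^ 3"
      unfolding S cs x_def[symmetric]
      using der M3 h t y(1,2) by (intro quasi_interpolation_runout) (auto simp: x_def)
  }
  {
    assume "h \<le> t"
    define m where "m = nat \<lfloor>t / h\<rfloor>"
    define y where "y = t / h - real m"
    have "1 \<le> t / h" using \<open>h \<le> t\<close> h by simp
    then have m: "m \<ge> 1" and y: "0 \<le> y" "y \<le> 1" "t / h = real m + y"
      unfolding y_def m_def by linarith+
    have t_eq: "t = (real m + y) * h" using y(3) h by (simp add: field_simps)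
    have cs: "c (m - 1) = spline_coeff h F (x + (y + 1) * h)"
      "c m = spline_coeff h F (x + y * h)" "c (m + 1) = spline_coeff h F (x + (y - 1) * h)"
      "c (m + 2) = spline_coeff h F (x + (y - 2) * h)"
      using m by (simp_all add: c_def x_def t_eq of_nat_diff algebra_simps)
    have "S = (\<Sum>j=0..n. c j * runout_basis j (real m + y))" by (simp add: S_def c_def y(3))
    also note runout_sum_interior[of n c, OF c m y(1,2)]
    finally have S: "S = c (m - 1) * centred_cubic (y + 1) + c m * centred_cubic y
      + c (m + 1) * centred_cubic (y - 1) + c (m + 2) * centred_cubic (y - 2)" .
    show "\<bar>S - F 0 (real n * h - t)\<bar> \<le> M4 * h ^ 4"
      unfolding S cs x_def[symmetric]
      using der M4 h \<open>0 \<le> t\<close> y(1,2) by (intro quasi_interpolation_interior) (auto simp: x_def)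
  }
qed

section \<open>The weights\<close>

lemma has_real_derivative_pos_part_power4:
  "((\<lambda>x::real. max 0 x ^ 4) has_real_derivative 4 * max 0 x ^ 3) (at x)"
proof (cases x "0::real" rule: linorder_cases)
  case less
  have "((\<lambda>x::real. 0) has_real_derivative 0) (at x)" by simp
  then have "((\<lambda>x::real. max 0 x ^ 4) has_real_derivative 0) (at x)"
    by (rule has_field_derivative_transform_within_open[of _ _ _ "{..<0}"]) (use less in auto)
  then show ?thesis using less by (simp add: max_def)
next
  case equal
  have "isCont (\<lambda>x::real. max 0 x ^ 3) 0" by (intro continuous_intros)
  moreover have "max 0 z ^ 4 = max 0 z ^ 3 * z" for z :: real
    by (auto simp: max_def power4_eq_xxxx power3_eq_cube)
  ultimately show ?thesis
    unfolding CARAT_DERIV equal by (intro exI[of _ "\<lambda>x. max 0 x ^ 3"]) auto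
next
  case greater
  have "((\<lambda>x::real. x ^ 4) has_real_derivative 4 * x ^ 3) (at x)"
    by (auto intro!: derivative_eq_intros)
  then have "((\<lambda>x::real. max 0 x ^ 4) has_real_derivative 4 * x ^ 3) (at x)"
    by (rule has_field_derivative_transform_within_open[of _ _ _ "{0<..}"]) (use greater in auto)
  then show ?thesis using greater by (simp add: max_def)
qed

text \<open>The truncated-power form integrated term by term; it rises from \<open>0\<close> left of
  the support to \<open>1\<close> right of it.\<close>

definition centred_cubic_primitive :: "real \<Rightarrow> real" where
  "centred_cubic_primitive t = (max 0 (t + 2) ^ 4 - 4 * max 0 (t + 1) ^ 4 + 6 * max 0 t ^ 4
     - 4 * max 0 (t - 1) ^ 4 + max 0 (t - 2) ^ 4) / 24"

lemma has_real_derivative_centred_cubic_primitive: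
  "(centred_cubic_primitive has_real_derivative centred_cubic t) (at t)"
proof -
  have "((\<lambda>x. max 0 (x + c) ^ 4) has_real_derivative 4 * max 0 (t + c) ^ 3) (at t)" for c :: real
    using has_real_derivative_pos_part_power4[of "t + c"]
      DERIV_shift[of "\<lambda>x. max 0 x ^ 4" "4 * max 0 (t + c) ^ 3" t c] by simp
  note d = this[of 2] this[of 1] this[of 0] this[of "-1"] this[of "-2"]
  have sum: "((\<lambda>x. (f2 x - 4 * f1 x + 6 * f0 x - 4 * g1 x + g2 x) / 24) has_real_derivative
      (a2 - 4 * a1 + 6 * a0 - 4 * b1 + b2) / 6) (at t)"
    if "(f2 has_real_derivative 4 * a2) (at t)" "(f1 has_real_derivative 4 * a1) (at t)"
      "(f0 has_real_derivative 4 * a0) (at t)" "(g1 has_real_derivative 4 * b1) (at t)"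
      "(g2 has_real_derivative 4 * b2) (at t)" for f2 f1 f0 g1 g2 :: "real \<Rightarrow> real" and a2 a1 a0 b1 b2
    using that by (auto intro!: derivative_eq_intros)
  show ?thesis
    unfolding centred_cubic_primitive_def[abs_def] centred_cubic_truncated_powers
    using sum[OF d] by simp
qed

lemma has_integral_centred_cubic_scaled:
  assumes "h > 0" "0 \<le> R"
  shows "((\<lambda>t. centred_cubic (t / h + c)) has_integral
    h * (centred_cubic_primitive (R / h + c) - centred_cubic_primitive c)) {0..R}"
proof -
  have "((\<lambda>t. h * centred_cubic_primitive (t / h + c)) has_real_derivative centred_cubic (t / h + c))
      (at t within {0..R})" for t
  proof -
    have "((\<lambda>t. t / h + c) has_real_derivative 1 / h) (at t within {0..R})"
      using \<open>h > 0\<close> by (auto intro!: derivative_eq_intros)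
    from DERIV_cmult[OF DERIV_chain2[OF has_real_derivative_centred_cubic_primitive this], of h]
    show ?thesis using \<open>h > 0\<close> by simp
  qed
  then show ?thesis
    using fundamental_theorem_of_calculus[of 0 R "\<lambda>t. h * centred_cubic_primitive (t / h + c)"
        "\<lambda>t. centred_cubic (t / h + c)"] assms
    by (simp add: has_real_derivative_iff_has_vector_derivative right_diff_distrib)
qed

text \<open>The integrals of the basis functions over the half-line. The plain translates at
  \<open>0\<close>, \<open>1\<close> and \<open>2\<close> have masses \<open>12 / 24\<close>,
  \<open>23 / 24\<close> and \<open>1\<close> there, and the one at \<open>-1\<close> has mass
  \<open>1 / 24\<close>, entering with factors \<open>3\<close>, \<open>-3\<close> and
  \<open>1\<close>.\<close>

definition runout_mass :: "nat \<Rightarrow> real" where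
  "runout_mass j = (if j = 0 then 15 / 24 else if j = 1 then 20 / 24 else if j = 2 then 25 / 24 else 1)"

lemma has_integral_runout_basis:
  assumes "h > 0" "j \<le> 3"
  shows "((\<lambda>t. runout_basis j (t / h)) has_integral h * runout_mass j) {0..5 * h}"
proof -
  \<comment> \<open>For \<open>j \<le> 3\<close> the support has ended by
    \<open>5 * h\<close>.\<close>
  note I = has_integral_centred_cubic_scaled[OF \<open>h > 0\<close>, of "5 * h"]
  have val: "centred_cubic_primitive 0 = 1 / 2" "centred_cubic_primitive 1 = 23 / 24"
    "centred_cubic_primitive (-1) = 1 / 24" "centred_cubic_primitive (-2) = 0"
    "centred_cubic_primitive (-3) = 0" "centred_cubic_primitive 2 = 1"
    "centred_cubic_primitive 3 = 1" "centred_cubic_primitive 4 = 1"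
    "centred_cubic_primitive 5 = 1" "centred_cubic_primitive 6 = 1"
    by (simp_all add: centred_cubic_primitive_def max_def)
  have "j = 0 \<or> j = 1 \<or> j = 2 \<or> j = 3" using \<open>j \<le> 3\<close> by linarith
  then consider "j = 0" | "j = 1" | "j = 2" | "j = 3" by blast
  then show ?thesis
  proof cases
    case 1
    show ?thesis
      using has_integral_add[OF I[of 0] has_integral_mult_right[OF I[of 1], of 3]] \<open>h > 0\<close>
      by (simp add: 1 runout_basis_def runout_mass_def val algebra_simps)
  next
    case 2
    show ?thesis
      using has_integral_diff[OF I[of "-1"] has_integral_mult_right[OF I[of 1], of 3]] \<open>h > 0\<close>
      by (simp add: 2 runout_basis_def runout_mass_def val algebra_simps)
  next
    case 3
    show ?thesis
      using has_integral_add[OF I[of "-2"] I[of 1]] \<open>h > 0\<close>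
      by (simp add: 3 runout_basis_def runout_mass_def val algebra_simps)
  next
    case 4
    show ?thesis
      using I[of "-3"] \<open>h > 0\<close>
      by (simp add: 4 runout_basis_def runout_mass_def val algebra_simps)
  qed
qed

section \<open>Dependence of the weights on the kernel\<close>

lemma weight_eq_integral:
  assumes "h > 0" "(real j + 2) * h \<le> R"
  shows "weight K h j = integral {0..R} (\<lambda>t. K t * runout_basis j (t / h))"
proof -
  have "runout_basis j (t / h) = 0" if "t > R" for t
    using that assms by (intro runout_basis_eq_0) (simp add: field_simps)
  then have "{t \<in> {0..} - {0..R}. K t * runout_basis j (t / h) \<noteq> 0} = {}" by auto
  moreover have "{t \<in> {0..R} - {0..}. K t * runout_basis j (t / h) \<noteq> 0} = {}" by auto
  ultimately show ?thesis
    unfolding weight_def by (intro integral_spike_set) (simp_all only: negligible_empty)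
qed

lemma weight_cong:
  assumes "h > 0" "(real j + 2) * h \<le> R" "\<And>t. t \<in> {0..R} \<Longrightarrow> K t = \<kappa> t"
  shows "weight K h j = weight \<kappa> h j"
  unfolding weight_eq_integral[OF assms(1,2)] by (intro integral_cong) (simp add: assms(3))

text \<open>With \<open>K\<close> merely integrable, only a bound by the integral norm is available,
  without any power of \<open>h\<close>; the smallness has to come from the coefficient that this
  difference multiplies.\<close>

lemma weight_diff_bound:
  assumes h: "h > 0" "(real j + 2) * h \<le> R" and K: "K absolutely_integrable_on {0..R}"
    and \<kappa>: "continuous_on {0..R} \<kappa>"
  shows "\<bar>weight K h j - weight \<kappa> h j\<bar> \<le> 4 * integral {0..R} (\<lambda>t. \<bar>K t - \<kappa> t\<bar>)"
proof -
  let ?\<phi> = "\<lambda>t. runout_basis j (t / h)"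
  have \<phi>: "continuous_on {0..R} ?\<phi>" using h by (intro continuous_intros) auto
  have "bounded (?\<phi> ` {0..R})"
    by (rule boundedI[of _ 4]) (auto simp: abs_runout_basis_le)
  then have int: "(\<lambda>t. ?\<phi> t * f t) absolutely_integrable_on {0..R}"
    if "f absolutely_integrable_on {0..R}" for f
    using \<phi> that by (intro absolutely_integrable_bounded_measurable_product_real)
      (auto intro: continuous_imp_measurable_on_sets_lebesgue)
  have \<kappa>': "\<kappa> absolutely_integrable_on {0..R}"
    using \<kappa> by (rule absolutely_integrable_continuous_real)
  have d: "(\<lambda>t. K t - \<kappa> t) absolutely_integrable_on {0..R}"
    using K \<kappa>' by (rule set_integral_diff)
  have "weight K h j - weight \<kappa> h j = integral {0..R} (\<lambda>t. K t * ?\<phi> t - \<kappa> t * ?\<phi> t)"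
    unfolding weight_eq_integral[OF h]
    using int[OF K] int[OF \<kappa>'] 
    by (subst integral_diff) (auto simp: mult.commute dest: set_lebesgue_integral_eq_integral(1))
  also have "\<dots> = integral {0..R} (\<lambda>t. ?\<phi> t * (K t - \<kappa> t))"
    by (simp add: algebra_simps)
  also have "\<bar>\<dots>\<bar> \<le> integral {0..R} (\<lambda>t. 4 * \<bar>K t - \<kappa> t\<bar>)"
    unfolding real_norm_def[symmetric]
  proof (rule integral_norm_bound_integral)
    show "(\<lambda>t. ?\<phi> t * (K t - \<kappa> t)) integrable_on {0..R}"
      using int[OF d] by (rule set_lebesgue_integral_eq_integral(1))
    show "(\<lambda>t. 4 * norm (K t - \<kappa> t)) integrable_on {0..R}"
      using d by (intro integrable_on_mult_right) (simp add: absolutely_integrable_on_def)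
    show "norm (?\<phi> t * (K t - \<kappa> t)) \<le> 4 * norm (K t - \<kappa> t)" for t
      using abs_runout_basis_le[of j "t / h"] by (simp add: abs_mult mult_right_mono)
  qed
  finally show ?thesis by simp
qed

text \<open>On an interval of length \<open>5 * h\<close> that contains the support, the kernel
  differs from \<open>1\<close> by at most \<open>5 * L * h\<close> and the basis function is at
  most \<open>4\<close>; the product gives \<open>100\<close>.\<close>

lemma weight_near_diagonal:
  assumes h: "h > 0" and lip: "\<And>x y. \<bar>\<kappa> x - \<kappa> y\<bar> \<le> L * \<bar>x - y\<bar>" and "\<kappa> 0 = 1"
    and cont: "continuous_on UNIV \<kappa>" and j: "j \<le> 3"
  shows "\<bar>weight \<kappa> h j - h * runout_mass j\<bar> \<le> 100 * L * h ^ 2"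
proof -
  have "0 \<le> L" using order_trans[OF abs_ge_zero lip[of 1 0]] by simp
  have "(real j + 2) * h \<le> 5 * h" using j h by (intro mult_right_mono) auto
  then have "weight \<kappa> h j = integral {0..5 * h} (\<lambda>t. \<kappa> t * runout_basis j (t / h))"
    using h by (intro weight_eq_integral)
  moreover have "continuous_on {0..5 * h} (\<lambda>t. runout_basis j (t / h))"
    using h by (intro continuous_intros) auto
  moreover have "continuous_on {0..5 * h} \<kappa>" using cont by (rule continuous_on_subset) auto
  ultimately have "weight \<kappa> h j - h * runout_mass j
      = integral {0..5 * h} (\<lambda>t. \<kappa> t * runout_basis j (t / h) - runout_basis j (t / h))"
    unfolding integral_unique[OF has_integral_runout_basis[OF h j], symmetric]
    by (subst integral_diff) (auto intro!: integrable_continuous_real continuous_intros)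
  also have "norm \<dots> \<le> (L * (5 * h) * 4) * (5 * h - 0)"
  proof (rule integral_bound)
    show "continuous_on {0..5 * h} (\<lambda>t. \<kappa> t * runout_basis j (t / h) - runout_basis j (t / h))"
      using h continuous_on_subset[OF cont] by (intro continuous_intros) auto
    fix t assume t: "t \<in> {0..5 * h}"
    have "\<bar>\<kappa> t - 1\<bar> \<le> L * (5 * h)"
      using lip[of t 0] t \<open>\<kappa> 0 = 1\<close> mult_left_mono[of t "5 * h" L] \<open>0 \<le> L\<close> by simp
    moreover have "\<kappa> t * runout_basis j (t / h) - runout_basis j (t / h)
      = (\<kappa> t - 1) * runout_basis j (t / h)" by (simp add: algebra_simps)
    ultimately show "norm (\<kappa> t * runout_basis j (t / h) - runout_basis j (t / h)) \<le> L * (5 * h) * 4"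
      using mult_mono[OF _ abs_runout_basis_le[of j "t / h"], of "\<bar>\<kappa> t - 1\<bar>" "L * (5 * h)"] \<open>0 \<le> L\<close> h
      by (simp add: abs_mult)
  qed (use h in auto)
  finally show ?thesis by (simp add: power2_eq_square)
qed

text \<open>From \<open>j = 3\<close> on, the basis function is a plain translate supported in the
  half-line. Moving it to the origin shifts the dependence on \<open>j\<close> into the kernel,
  where Lipschitz continuity can act.\<close>

lemma weight_far_eq:
  assumes h: "h > 0" and j: "j \<ge> 3"
  shows "weight \<kappa> h j = integral {-(2 * h)..2 * h} (\<lambda>s. \<kappa> (s + real j * h) * centred_cubic (s / h))"
proof -
  let ?f = "\<lambda>t. \<kappa> t * centred_cubic (t / h - real j)"
  have "weight \<kappa> h j = integral {0..(real j + 2) * h} ?f"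
    using j by (subst weight_eq_integral[OF h order_refl]) (simp add: runout_basis_def)
  also have "\<dots> = integral {(real j - 2) * h..(real j + 2) * h} ?f"
  proof (rule integral_spike_set)
    have "?f t = 0" if "t < (real j - 2) * h" for t
    proof -
      have "t / h < real j - 2" using that h by (simp add: field_simps)
      then show ?thesis by (simp add: centred_cubic_eq_0)
    qed
    then have "{t \<in> {0..(real j + 2) * h} - {(real j - 2) * h..(real j + 2) * h}. ?f t \<noteq> 0} = {}"
      by force
    then show "negligible {t \<in> {0..(real j + 2) * h} - {(real j - 2) * h..(real j + 2) * h}. ?f t \<noteq> 0}"
      by (simp only: negligible_empty)
    have "0 \<le> (real j - 2) * h" using j h by simp
    then have "{t \<in> {(real j - 2) * h..(real j + 2) * h} - {0..(real j + 2) * h}. ?f t \<noteq> 0} = {}"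
      by auto
    then show "negligible {t \<in> {(real j - 2) * h..(real j + 2) * h} - {0..(real j + 2) * h}. ?f t \<noteq> 0}"
      by (simp only: negligible_empty)
  qed
  also have "\<dots> = integral {(real j - 2) * h - real j * h..(real j + 2) * h - real j * h}
      (\<lambda>s. ?f (s + real j * h))"
    by (rule integral_shift_real_ivl[symmetric])
  also have "\<dots> = integral {-(2 * h)..2 * h} (\<lambda>s. \<kappa> (s + real j * h) * centred_cubic (s / h))"
    using h by (simp add: algebra_simps add_divide_distrib)
  finally show ?thesis .
qed

text \<open>The kernel changes by at most \<open>L * h\<close> over one step, on a support of length
  \<open>4 * h\<close>. The range starts at \<open>4\<close> so that the index \<open>j - 1\<close>
  is also free of corrections.\<close>

lemma weight_far_diff:
  assumes h: "h > 0" and lip: "\<And>x y. \<bar>\<kappa> x - \<kappa> y\<bar> \<le> L * \<bar>x - y\<bar>"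
    and cont: "continuous_on UNIV \<kappa>" and j: "j \<ge> 4"
  shows "\<bar>weight \<kappa> h j - weight \<kappa> h (j - 1)\<bar> \<le> 4 * L * h ^ 2"
proof -
  have c: "continuous_on {-(2 * h)..2 * h} (\<lambda>s. \<kappa> (s + c) * centred_cubic (s / h))" for c
    using h by (intro continuous_intros continuous_on_compose2[OF cont]) auto
  have "weight \<kappa> h j - weight \<kappa> h (j - 1) = integral {-(2 * h)..2 * h}
     (\<lambda>s. \<kappa> (s + real j * h) * centred_cubic (s / h) - \<kappa> (s + real (j - 1) * h) * centred_cubic (s / h))"
    using j by (subst weight_far_eq[OF h], simp, subst weight_far_eq[OF h], simp)
      (intro integral_diff[symmetric] integrable_continuous_real c)
  also have "norm \<dots> \<le> (L * h) * (2 * h - (-(2 * h)))"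
  proof (rule integral_bound)
    fix s
    have "\<bar>\<kappa> (s + real j * h) - \<kappa> (s + real (j - 1) * h)\<bar> \<le> L * h"
      using lip[of "s + real j * h" "s + real (j - 1) * h"] h j
      by (simp add: of_nat_diff algebra_simps)
    moreover have "\<kappa> (s + real j * h) * centred_cubic (s / h) - \<kappa> (s + real (j - 1) * h) * centred_cubic (s / h)
       = (\<kappa> (s + real j * h) - \<kappa> (s + real (j - 1) * h)) * centred_cubic (s / h)"
      by (simp add: left_diff_distrib)
    ultimately show "norm (\<kappa> (s + real j * h) * centred_cubic (s / h)
        - \<kappa> (s + real (j - 1) * h) * centred_cubic (s / h)) \<le> L * h"
      using centred_cubic_bounds[of "s / h"] mult_mono[of "\<bar>\<kappa> (s + real j * h) - \<kappa> (s + real (j - 1) * h)\<bar>"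
         "L * h" "\<bar>centred_cubic (s / h)\<bar>" 1]
      by (simp add: abs_mult del: abs_of_nonneg)
  qed (use h c in \<open>auto intro!: continuous_on_diff\<close>)
  finally show ?thesis by (simp add: power2_eq_square)
qed

section \<open>Stability of the recursion\<close>

text \<open>A discrete Gronwall argument, counted in units of \<open>h / 72\<close>. The diagonal
  coefficient is at least \<open>45 - 1 = 44\<close>. On the other side, the three main differences
  cost \<open>33\<close>, the accumulated perturbations of size \<open>L * h\<close> cost
  \<open>4\<close> and the residual costs \<open>4\<close>, in total \<open>41\<close>. The
  perturbations are absorbed by the geometric growth of the bound.\<close>

lemma recursion_stability:
  fixes q \<epsilon> :: "nat \<Rightarrow> real"
  assumes h: "h > 0" "72 * (L * h) \<le> 1" and L: "L \<ge> 0" and C: "C \<ge> 0"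
    and q0: "(15 / 24 - L * h) * h \<le> q 0"
    and q1: "\<bar>q 1 - q 0\<bar> \<le> (5 / 24 + L * h) * h" and q2: "\<bar>q 2 - q 1\<bar> \<le> (5 / 24 + L * h) * h"
    and q3: "\<bar>q 3 - q 2\<bar> \<le> (1 / 24 + L * h) * h"
    and qj: "\<And>j. 4 \<le> j \<Longrightarrow> \<bar>q j - q (j - 1)\<bar> \<le> L * h * h"
    and zero: "\<epsilon> 0 = 0"
    and res: "\<And>n. 1 \<le> n \<Longrightarrow> n \<le> N \<Longrightarrow>
      \<bar>(\<Sum>j=0..n. q j * \<epsilon> (n - j)) - (\<Sum>j=0..n-1. q j * \<epsilon> (n - 1 - j))\<bar> \<le> C * h ^ 5"
    and n: "n \<le> N"
  shows "\<bar>\<epsilon> n\<bar> \<le> (18 * C + 1) * h ^ 4 * (1 + (18 * L + 1) * h) ^ n"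
  using n
proof (induction n rule: less_induct)
  case (less n)
  \<comment> \<open>The factor \<open>18\<close> is chosen so that the residual and the geometric
    sum each cost at most \<open>g n / 18\<close>. Adding one keeps \<open>\<beta>\<close> positive,
    also for \<open>L = 0\<close>, so that the geometric sum can be divided by it.\<close>
  define A where "A = 18 * C + 1"
  define \<beta> where "\<beta> = 18 * L + 1"
  define g where "g = (\<lambda>k::nat. A * h ^ 4 * (1 + \<beta> * h) ^ k)"
  have pos: "A \<ge> 1" "\<beta> \<ge> 1" "\<beta> * h > 0" using C L h by (auto simp: A_def \<beta>_def)
  have g_mono: "g k \<le> g l" if "k \<le> l" for k l
    using that pos h unfolding g_def by (intro mult_left_mono power_increasing) auto
  have g_ge: "A * h ^ 4 \<le> g k" for k
    using g_mono[of 0 k] by (simp add: g_def)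
  have g_pos: "0 \<le> g k" for k using pos h by (simp add: g_def)
  show ?case
  proof (cases "n = 0")
    case True
    then show ?thesis using zero C h by simp
  next
    case False
    \<comment> \<open>The absolute values of the coefficients \<open>5\<close>, \<open>5\<close> and
      \<open>-1\<close>, over \<open>24\<close>.\<close>
    define \<mu> where "\<mu> = (\<lambda>j::nat. if j = 1 \<or> j = 2 then 5 / 24 else if j = 3 then 1 / 24 else 0 :: real)"
    define d where "d = (\<lambda>j. q j - q (j - 1))"
    have d: "\<bar>d j\<bar> \<le> (\<mu> j + L * h) * h" if "j \<ge> 1" for j
    proof -
      have "j = 1 \<or> j = 2 \<or> j = 3 \<or> j \<ge> 4" using that by linarith
      then show ?thesis
        using q1 q2 q3 qj[of j] by (elim disjE) (auto simp: d_def \<mu>_def)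
    qed
    have split: "(\<Sum>j=0..n. q j * \<epsilon> (n - j)) - (\<Sum>j=0..n-1. q j * \<epsilon> (n - 1 - j))
      = q 0 * \<epsilon> n + (\<Sum>j=1..n. d j * \<epsilon> (n - j))"
    proof -
      have "(\<Sum>j=0..n. q j * \<epsilon> (n - j)) = q 0 * \<epsilon> n + (\<Sum>j=1..n. q j * \<epsilon> (n - j))"
        by (simp add: sum.atLeast_Suc_atMost)
      moreover have "(\<Sum>j=0..n-1. q j * \<epsilon> (n - 1 - j)) = (\<Sum>j=1..n. q (j - 1) * \<epsilon> (n - j))"
        using False by (intro sum.reindex_bij_witness[of _ "\<lambda>j. j - 1" Suc]) auto
      ultimately show ?thesis
        by (simp add: d_def left_diff_distrib sum_subtractf)
    qed
    have mu_sum: "(\<Sum>j=1..n. \<mu> j) \<le> 11 / 24"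
    proof -
      have "(\<Sum>j=1..n. \<mu> j) \<le> (\<Sum>j=1..n+3. \<mu> j)"
        by (intro sum_mono2) (auto simp: \<mu>_def)
      also have "\<dots> = (\<Sum>j\<in>{1,2,3}. \<mu> j)"
        by (intro sum.mono_neutral_right) (auto simp: \<mu>_def)
      also have "\<dots> = 11 / 24" by (simp add: \<mu>_def)
      finally show ?thesis .
    qed
    have geo: "(\<Sum>j=1..n. L * h * g (n - j)) \<le> g n / 18"
    proof -
      have "(\<Sum>j=1..n. L * h * g (n - j)) = (\<Sum>k<n. L * h * g k)"
        by (intro sum.reindex_bij_witness[of _ "\<lambda>k. n - k" "\<lambda>j. n - j"]) auto
      also have "\<dots> = L * h * (A * h ^ 4) * (\<Sum>k<n. (1 + \<beta> * h) ^ k)"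
        by (simp add: g_def sum_distrib_left mult.assoc)
      also have "\<dots> = L * h * (A * h ^ 4) * (((1 + \<beta> * h) ^ n - 1) / (\<beta> * h))"
        using pos by (subst geometric_sum) auto
      also have "\<dots> = L / \<beta> * (A * h ^ 4 * ((1 + \<beta> * h) ^ n - 1))"
        using h by simp
      also have "\<dots> \<le> 1 / 18 * g n"
      proof (rule mult_mono)
        show "L / \<beta> \<le> 1 / 18" using L by (simp add: \<beta>_def field_simps)
        show "A * h ^ 4 * ((1 + \<beta> * h) ^ n - 1) \<le> g n"
          using pos h by (simp add: g_def)
      qed (use pos h in auto)
      finally show ?thesis by simp
    qed
    have "\<bar>\<Sum>j=1..n. d j * \<epsilon> (n - j)\<bar> \<le> (\<Sum>j=1..n. (\<mu> j + L * h) * h * g (n - j))"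
    proof (rule order_trans[OF sum_abs], rule sum_mono)
      fix j assume j: "j \<in> {1..n}"
      have "\<bar>\<epsilon> (n - j)\<bar> \<le> g (n - j)"
        using less.IH[of "n - j"] j less.prems False by (simp add: g_def A_def \<beta>_def)
      then show "\<bar>d j * \<epsilon> (n - j)\<bar> \<le> (\<mu> j + L * h) * h * g (n - j)"
        unfolding abs_mult using d[of j] j by (intro mult_mono) auto
    qed
    also have "\<dots> = h * ((\<Sum>j=1..n. \<mu> j * g (n - j)) + (\<Sum>j=1..n. L * h * g (n - j)))"
      unfolding sum.distrib[symmetric] sum_distrib_left by (intro sum.cong) (auto simp: algebra_simps)
    also have "\<dots> \<le> h * (11 / 24 * g n + g n / 18)"
    proof (intro mult_left_mono add_mono geo)
      have "(\<Sum>j=1..n. \<mu> j * g (n - j)) \<le> (\<Sum>j=1..n. \<mu> j * g n)"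
        by (intro sum_mono mult_left_mono g_mono) (auto simp: \<mu>_def)
      also have "\<dots> \<le> 11 / 24 * g n"
        unfolding sum_distrib_right[symmetric] using mu_sum g_pos by (intro mult_right_mono) auto
      finally show "(\<Sum>j=1..n. \<mu> j * g (n - j)) \<le> 11 / 24 * g n" .
    qed (use h in auto)
    finally have s: "\<bar>\<Sum>j=1..n. d j * \<epsilon> (n - j)\<bar> \<le> h * (11 / 24 * g n + g n / 18)" .
    have "C * h ^ 5 = h * (C * h ^ 4)" by (simp add: eval_nat_numeral)
    also have "\<dots> \<le> h * (g n / 18)"
    proof (rule mult_left_mono)
      have "C * h ^ 4 \<le> A * h ^ 4 / 18" using h by (simp add: A_def field_simps)
      then show "C * h ^ 4 \<le> g n / 18" using g_ge[of n] by simp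
    qed (use h in auto)
    finally have r: "C * h ^ 5 \<le> h * (g n / 18)" .
    have "h * (44 / 72 * \<bar>\<epsilon> n\<bar>) \<le> q 0 * \<bar>\<epsilon> n\<bar>"
    proof -
      have "44 / 72 * h \<le> (15 / 24 - L * h) * h" using h by (intro mult_right_mono) auto
      then have "44 / 72 * h \<le> q 0" using q0 by linarith
      then have "44 / 72 * h * \<bar>\<epsilon> n\<bar> \<le> q 0 * \<bar>\<epsilon> n\<bar>" by (rule mult_right_mono) auto
      then show ?thesis by (simp add: ac_simps)
    qed
    also have "\<dots> \<le> \<bar>q 0 * \<epsilon> n\<bar>" by (simp add: abs_mult mult_right_mono)
    also have "\<dots> \<le> h * (g n / 18) + h * (11 / 24 * g n + g n / 18)"
      using res[of n] s r less.prems False unfolding split by linarith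
    also have "\<dots> = h * (41 / 72 * g n)" by (simp add: field_simps)
    finally have "44 / 72 * \<bar>\<epsilon> n\<bar> \<le> 41 / 72 * g n" using h by simp
    then have "\<bar>\<epsilon> n\<bar> \<le> g n" using g_pos[of n] by linarith
    then show ?thesis by (simp add: g_def A_def \<beta>_def)
  qed
qed

section \<open>Vanishing of the solution at zero and consistency\<close>

lemma continuous_on_UNIV_bounded:
  fixes f :: "real \<Rightarrow> real"
  assumes "continuous_on UNIV f"
  obtains M where "M \<ge> 0" "\<And>x. x \<in> {a..b} \<Longrightarrow> \<bar>f x\<bar> \<le> M"
proof -
  have "bounded (f ` {a..b})"
    by (intro compact_imp_bounded compact_continuous_image continuous_on_subset[OF assms]) auto
  then obtain M where "\<forall>x\<in>{a..b}. \<bar>f x\<bar> \<le> M" unfolding bounded_iff by auto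
  then show ?thesis by (intro that[of "max 0 M"]) (auto intro: max.coboundedI2)
qed

lemma zero_if_abs_le_linear:
  fixes c :: real
  assumes "\<And>t. 0 < t \<Longrightarrow> t \<le> s \<Longrightarrow> \<bar>c\<bar> \<le> D * t" and "0 < s"
  shows "c = 0"
proof -
  have "\<forall>\<^sub>F t in at_right 0. \<bar>c\<bar> \<le> D * t"
    unfolding eventually_at_right_field using assms by (intro exI[of _ s]) auto
  moreover have "((\<lambda>t. D * t) \<longlongrightarrow> D * 0) (at_right 0)" by (intro tendsto_intros)
  ultimately have "\<bar>c\<bar> \<le> D * 0"
    by (intro tendsto_lowerbound[of "\<lambda>t. D * t" _ "at_right 0"]) auto
  then show ?thesis by simp
qed

lemma has_integral_shifted_power:
  assumes "0 \<le> t"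
  shows "((\<lambda>s. (t - s) ^ p) has_integral t ^ Suc p / real (Suc p)) {0..t}"
proof -
  have "((\<lambda>s. - ((t - s) ^ Suc p) / real (Suc p)) has_real_derivative (t - s) ^ p) (at s within {0..t})"
    for s
    by (auto intro!: derivative_eq_intros simp del: power_Suc of_nat_Suc) 
  then show ?thesis
    using fundamental_theorem_of_calculus[of 0 t "\<lambda>s. - ((t - s) ^ Suc p) / real (Suc p)" "\<lambda>s. (t - s) ^ p"] assms
    by (simp add: has_real_derivative_iff_has_vector_derivative del: of_nat_Suc)
qed

text \<open>
  If \<open>p\<close> is the first order with \<open>V p 0 \<noteq> 0\<close>, then the convolution is asymptotic to a nonzero
  multiple of \<open>t ^ (p + 1)\<close> at \<open>0\<close>, too large for \<open>a\<close>.
\<close>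
lemma volterra_derivatives_vanish:
  fixes V :: "nat \<Rightarrow> real \<Rightarrow> real"
  assumes "T > 0"
    and lip: "\<And>x y. \<bar>\<kappa> x - \<kappa> y\<bar> \<le> L * \<bar>x - y\<bar>" and "\<kappa> 0 = 1" and cont: "continuous_on UNIV \<kappa>"
    and der: "\<And>p x. p < k \<Longrightarrow> (V p has_real_derivative V (Suc p) x) (at x)"
    and contV: "\<And>p. p \<le> k \<Longrightarrow> continuous_on UNIV (V p)"
    and eq: "\<And>t. t \<in> {0..T} \<Longrightarrow> integral {0..t} (\<lambda>s. \<kappa> s * V 0 (t - s)) = a t"
    and a: "\<And>t. t \<in> {0..T} \<Longrightarrow> \<bar>a t\<bar> \<le> Ca * t ^ Suc k"
    and "p < k"
  shows "V p 0 = 0"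
  using \<open>p < k\<close>
proof (induction p rule: less_induct)
  case (less p)
  \<comment> \<open>All lower Taylor coefficients vanish by the induction hypothesis, so
    \<open>c\<close> is the leading one.\<close>
  define c where "c = V p 0 / fact p"
  have "0 \<le> L" using order_trans[OF abs_ge_zero lip[of 1 0]] by simp
  have "0 \<le> Ca * T ^ Suc k" using order_trans[OF abs_ge_zero a[of T]] \<open>T > 0\<close> by simp
  then have "0 \<le> Ca"
    using zero_less_power[OF \<open>T > 0\<close>, of "Suc k"] by (simp add: zero_le_mult_iff del: power_Suc)
  obtain M where M: "M \<ge> 0" "\<And>x. x \<in> {-T..T} \<Longrightarrow> \<bar>V (Suc p) x\<bar> \<le> M"
    by (rule continuous_on_UNIV_bounded[OF contV[OF Suc_leI[OF less.prems]], of "-T" T]) (rule that)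
  have V0: "\<bar>V 0 r - c * r ^ p\<bar> \<le> M * r ^ Suc p" if "r \<in> {0..T}" for r
  proof -
    have "\<bar>V 0 (0 + r) - (\<Sum>m<Suc p. V m 0 / fact m * r ^ m)\<bar> \<le> M / fact (Suc p) * \<bar>r\<bar> ^ Suc p"
      using that less.prems by (intro taylor_remainder_bound der M(2)) auto
    moreover have "(\<Sum>m<Suc p. V m 0 / fact m * r ^ m) = c * r ^ p"
      using less.IH less.prems by (simp add: c_def)
    moreover have "M / fact (Suc p) * \<bar>r\<bar> ^ Suc p \<le> M * r ^ Suc p"
    proof -
      have "M / fact (Suc p) \<le> M / 1"
        using M(1) by (intro divide_left_mono fact_ge_1) auto
      then show ?thesis using that M(1) by (intro mult_mono) auto
    qed
    ultimately show ?thesis by simp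
  qed
  \<comment> \<open>The first summand accounts for replacing the kernel by its value
    \<open>1\<close> at \<open>0\<close>, the second for replacing \<open>V 0\<close> by its leading
    term.\<close>
  define D where "D = L * (\<bar>c\<bar> + M) + M"
  have bound: "\<bar>c / real (Suc p)\<bar> \<le> (D + Ca) * t" if t: "0 < t" "t \<le> min 1 T" for t
  proof -
    have tT: "t \<in> {0..T}" "t \<le> 1" using t by auto
    have "continuous_on {0..t} (\<lambda>s. V 0 (t - s))"
      by (rule continuous_on_compose2[OF contV[of 0]]) (auto intro!: continuous_intros)
    then have contf: "continuous_on {0..t} (\<lambda>s. \<kappa> s * V 0 (t - s))"
      using continuous_on_subset[OF cont subset_UNIV] by (intro continuous_on_mult)
    have int: "((\<lambda>s. c * (t - s) ^ p) has_integral c * (t ^ Suc p / real (Suc p))) {0..t}"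
      using t by (intro has_integral_mult_right has_integral_shifted_power) auto
    have "a t - c * (t ^ Suc p / real (Suc p))
      = integral {0..t} (\<lambda>s. \<kappa> s * V 0 (t - s) - c * (t - s) ^ p)"
      unfolding eq[OF tT(1), symmetric] integral_unique[OF int, symmetric]
      by (intro integral_diff[symmetric] integrable_continuous_real contf has_integral_integrable[OF int])
    also have "norm \<dots> \<le> (D * t ^ Suc p) * (t - 0)"
    proof (rule integral_bound)
      show "continuous_on {0..t} (\<lambda>s. \<kappa> s * V 0 (t - s) - c * (t - s) ^ p)"
        by (intro continuous_on_diff contf continuous_intros)
      fix s assume s: "s \<in> {0..t}"
      define r where "r = t - s"
      have r: "r \<in> {0..T}" "0 \<le> r" "r \<le> t" using s t by (auto simp: r_def)
      have "\<bar>\<kappa> s - 1\<bar> \<le> L * t"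
        using lip[of s 0] s \<open>\<kappa> 0 = 1\<close> mult_left_mono[of s t L] \<open>0 \<le> L\<close> by simp
      moreover have "\<bar>V 0 r\<bar> \<le> (\<bar>c\<bar> + M) * t ^ p"
      proof -
        have "r ^ Suc p \<le> 1 * t ^ p"
          unfolding power_Suc using r tT(2) by (intro mult_mono power_mono) auto
        then have "M * r ^ Suc p \<le> M * t ^ p" using M(1) by (intro mult_left_mono) auto
        moreover have "\<bar>c * r ^ p\<bar> \<le> \<bar>c\<bar> * t ^ p"
          using r by (simp add: abs_mult mult_left_mono power_mono)
        ultimately show ?thesis using V0[OF r(1)] unfolding distrib_right by linarith
      qed
      ultimately have "\<bar>(\<kappa> s - 1) * V 0 r\<bar> \<le> (L * t) * ((\<bar>c\<bar> + M) * t ^ p)"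
        unfolding abs_mult using \<open>0 \<le> L\<close> t by (intro mult_mono) auto
      moreover have "M * r ^ Suc p \<le> M * t ^ Suc p"
        using M(1) r by (intro mult_left_mono power_mono) auto
      moreover have "\<kappa> s * V 0 r - c * r ^ p = (\<kappa> s - 1) * V 0 r + (V 0 r - c * r ^ p)"
        by (simp add: algebra_simps)
      ultimately have "\<bar>\<kappa> s * V 0 r - c * r ^ p\<bar> \<le> (L * t) * ((\<bar>c\<bar> + M) * t ^ p) + M * t ^ Suc p"
        using V0[OF r(1)] by linarith
      then show "norm (\<kappa> s * V 0 (t - s) - c * (t - s) ^ p) \<le> D * t ^ Suc p"
        by (simp add: D_def r_def algebra_simps)
    qed (use t in auto)
    finally have "\<bar>a t - c * (t ^ Suc p / real (Suc p))\<bar> \<le> D * t * t ^ Suc p"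
      by (simp add: ac_simps)
    moreover have "\<bar>a t\<bar> \<le> Ca * t * t ^ Suc p"
    proof -
      \<comment> \<open>Since \<open>p < k\<close> and \<open>t \<le> 1\<close>, the right-hand side
        \<open>a\<close> is smaller than \<open>t ^ Suc p\<close> by at least one factor
        \<open>t\<close>.\<close>
      have "t ^ Suc k \<le> t ^ Suc (Suc p)"
        using t less.prems by (intro power_decreasing) auto
      then have "Ca * t ^ Suc k \<le> Ca * (t * t ^ Suc p)" using \<open>0 \<le> Ca\<close> by (intro mult_left_mono) auto
      then show ?thesis using a[OF tT(1)] by (simp only: mult.assoc)
    qed
    ultimately have "\<bar>c * (t ^ Suc p / real (Suc p))\<bar> \<le> (D * t) * t ^ Suc p + (Ca * t) * t ^ Suc p"
      by linarith
    also have "\<dots> = (D + Ca) * t * t ^ Suc p" by (simp only: distrib_right)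
    finally have "\<bar>c / real (Suc p)\<bar> * t ^ Suc p \<le> (D + Ca) * t * t ^ Suc p"
      using t by (simp add: abs_mult)
    then show ?thesis using t by (simp only: mult_le_cancel_right_pos zero_less_power)
  qed
  have "c / real (Suc p) = 0"
    using bound \<open>T > 0\<close> by (intro zero_if_abs_le_linear[of "min 1 T" _ "D + Ca"]) auto
  then show ?case by (simp add: c_def)
qed

text \<open>By linearity the weighted sum is the integral of the kernel against a spline, so
  comparing it with the convolution leaves the kernel against the spline error. All supports lie in
  \<open>{0..R}\<close>, and one interval serves every term.\<close>

lemma scheme_defect_integral:
  assumes h: "h > 0" and cont: "continuous_on UNIV \<kappa>" and contU: "continuous_on UNIV U"
    and R: "(real n + 2) * h \<le> R"
  shows "(\<Sum>j=0..n. weight \<kappa> h j * W j) - integral {0..R} (\<lambda>t. \<kappa> t * U (\<tau> - t))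
    = integral {0..R} (\<lambda>t. \<kappa> t * ((\<Sum>j=0..n. W j * runout_basis j (t / h)) - U (\<tau> - t)))"
proof -
  have c: "continuous_on {0..R} \<kappa>" "continuous_on {0..R} (\<lambda>t. U (\<tau> - t))"
    "continuous_on {0..R} (\<lambda>t. runout_basis j (t / h))" for j
  proof -
    show "continuous_on {0..R} \<kappa>" by (rule continuous_on_subset[OF cont]) simp
    show "continuous_on {0..R} (\<lambda>t. U (\<tau> - t))"
      by (rule continuous_on_compose2[OF contU]) (auto intro!: continuous_intros)
    show "continuous_on {0..R} (\<lambda>t. runout_basis j (t / h))"
      using h by (intro continuous_intros) auto
  qed
  have "weight \<kappa> h j * W j = integral {0..R} (\<lambda>t. \<kappa> t * (W j * runout_basis j (t / h)))" if "j \<le> n" for j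
  proof -
    have jR: "(real j + 2) * h \<le> (real n + 2) * h" using that h by (intro mult_right_mono) auto
    show ?thesis
      using order_trans[OF jR R] h
      by (subst weight_eq_integral[of _ _ R]) (auto simp: ac_simps simp flip: integral_mult_left)
  qed
  then have "(\<Sum>j=0..n. weight \<kappa> h j * W j)
      = (\<Sum>j=0..n. integral {0..R} (\<lambda>t. \<kappa> t * (W j * runout_basis j (t / h))))" by simp
  also have "\<dots> = integral {0..R} (\<lambda>t. \<Sum>j=0..n. \<kappa> t * (W j * runout_basis j (t / h)))"
    by (intro Henstock_Kurzweil_Integration.integral_sum[symmetric] integrable_continuous_real
      continuous_on_mult continuous_on_const c) auto
  finally show ?thesis
    unfolding sum_distrib_left[symmetric] right_diff_distrib
    by (simp only:) (intro integral_diff[symmetric] integrable_continuous_real continuous_on_mult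
      continuous_on_sum continuous_on_const c)
qed

text \<open>
  The runout error is only \<open>O(h\<^sup>3)\<close>, but it lives on an interval of length \<open>h\<close>; the last power of
  \<open>h\<close> comes from applying the quasi-interpolation estimates to the backward difference of \<open>U\<close>.
\<close>
lemma scheme_consistency:
  fixes U :: "nat \<Rightarrow> real \<Rightarrow> real"
  assumes h: "h > 0" and cont: "continuous_on UNIV \<kappa>"
    and R: "(real n + 2) * h \<le> R" and \<kappa>: "\<And>t. t \<in> {0..R} \<Longrightarrow> \<bar>\<kappa> t\<bar> \<le> B"
    and der: "\<And>p x. p < 5 \<Longrightarrow> (U p has_real_derivative U (Suc p) x) (at x)"
    and M4: "\<And>x. x \<le> real n * h + 3 * h \<Longrightarrow> \<bar>U 4 x\<bar> \<le> M4" and M5: "\<And>x. \<bar>U 5 x\<bar> \<le> M5"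
    and zero: "\<And>x. x \<le> 0 \<Longrightarrow> U 0 x = 0" "\<And>x. x \<le> 0 \<Longrightarrow> U 2 x = 0"
    and a: "\<And>m. m \<le> n \<Longrightarrow> integral {0..real m * h} (\<lambda>s. \<kappa> s * U 0 (real m * h - s)) = a (real m * h)"
    and n: "n \<ge> 1"
  defines "\<delta> \<equiv> \<lambda>m. (\<Sum>j=0..m. weight \<kappa> h j * spline_coeff h U (real (m - j) * h)) - a (real m * h)"
  shows "\<bar>\<delta> n - \<delta> (n - 1)\<bar> \<le> B * (20 * M4 + R * M5) * h ^ 5"
proof -
  let ?W = "spline_coeff h U"
  have contU: "continuous_on UNIV (U p)" if "p < 5" for p
    using der[OF that] by (meson DERIV_isCont continuous_at_imp_continuous_on)
  have W0: "?W x = 0" if "x \<le> 0" for x using zero that by (simp add: spline_coeff_def)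
  have "0 \<le> R" using R h by (smt (verit) mult_nonneg_nonneg of_nat_0_le_iff)
  have "0 \<le> B" using order_trans[OF abs_ge_zero \<kappa>[of 0]] \<open>0 \<le> R\<close> by simp
  have "0 \<le> M5" using order_trans[OF abs_ge_zero M5] .
  have "1 * h \<le> (real n + 2) * h" using h by (intro mult_right_mono) auto
  then have hR: "h \<le> R" using R by linarith
  \<comment> \<open>Both time levels use basis functions up to index \<open>n\<close>; at level
    \<open>n - 1\<close> the extra coefficient is taken at \<open>-h\<close>, where it is
    zero.\<close>
  define S where "S = (\<lambda>x t. (\<Sum>j=0..n. ?W (x - real j * h) * runout_basis j (t / h)) - U 0 (x - t))"
  have \<delta>: "\<delta> m = integral {0..R} (\<lambda>t. \<kappa> t * S (real m * h) t)" if m: "m \<le> n" for m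
  proof -
    have "real m * h \<le> (real n + 2) * h" using m h by (intro mult_right_mono) auto
    then have mR: "real m * h \<le> R" using R by linarith
    have "integral {0..real m * h} (\<lambda>s. \<kappa> s * U 0 (real m * h - s))
      = integral {0..R} (\<lambda>s. \<kappa> s * U 0 (real m * h - s))"
    proof (rule integral_spike_set)
      have "{s \<in> {0..real m * h} - {0..R}. \<kappa> s * U 0 (real m * h - s) \<noteq> 0} = {}"
        using mR by auto
      then show "negligible {s \<in> {0..real m * h} - {0..R}. \<kappa> s * U 0 (real m * h - s) \<noteq> 0}"
        by (simp only: negligible_empty)
      have "{s \<in> {0..R} - {0..real m * h}. \<kappa> s * U 0 (real m * h - s) \<noteq> 0} = {}"
        using zero(1) by auto
      then show "negligible {s \<in> {0..R} - {0..real m * h}. \<kappa> s * U 0 (real m * h - s) \<noteq> 0}"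
        by (simp only: negligible_empty)
    qed
    moreover have "(\<Sum>j=0..m. weight \<kappa> h j * ?W (real (m - j) * h))
        = (\<Sum>j=0..n. weight \<kappa> h j * ?W (real m * h - real j * h))"
    proof (rule sum.mono_neutral_cong_left)
      show "\<forall>j\<in>{0..n} - {0..m}. weight \<kappa> h j * ?W (real m * h - real j * h) = 0"
        using h by (auto intro!: W0 mult_right_mono)
    qed (use m in \<open>auto simp: of_nat_diff left_diff_distrib\<close>)
    ultimately show ?thesis
      unfolding \<delta>_def S_def a[OF m, symmetric]
      using scheme_defect_integral[OF h cont contU R, of 0 "\<lambda>j. ?W (real m * h - real j * h)" "real m * h"]
      by simp
  qed
  \<comment> \<open>Differencing commutes with differentiation, so \<open>D\<close> is again a
    family of derivatives, with bounds that gain a factor \<open>h\<close>: \<open>D 3\<close> is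
    controlled by \<open>U 4\<close>, and \<open>D 4\<close> by \<open>U 5\<close>.\<close>
  define D where "D = (\<lambda>p x. U p x - U p (x - h))"
  define \<Psi> where "\<Psi> = (\<lambda>t. (\<Sum>j=0..n. spline_coeff h D (real n * h - real j * h) * runout_basis j (t / h))
    - D 0 (real n * h - t))"
  have contS: "continuous_on A (S x)" for A x
  proof -
    have "continuous_on A (\<lambda>t. U 0 (x - t))"
      by (rule continuous_on_compose2[OF contU[of 0]]) (auto intro!: continuous_intros)
    then show ?thesis unfolding S_def using h by (intro continuous_intros) auto
  qed
  have cont_\<kappa>: "continuous_on A \<kappa>" for A using cont by (rule continuous_on_subset) auto
  have W_diff: "?W x - ?W (x - h) = spline_coeff h D x" for x
    by (simp add: spline_coeff_def D_def algebra_simps)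
  have S_diff: "S (real n * h) t - S (real (n - 1) * h) t = \<Psi> t" for t
  proof -
    have x: "real (n - 1) * h = real n * h - h" using n by (simp add: of_nat_diff algebra_simps)
    have "S (real n * h) t - S (real (n - 1) * h) t
      = (\<Sum>j=0..n. (?W (real n * h - real j * h) - ?W (real n * h - real j * h - h)) * runout_basis j (t / h))
        - (U 0 (real n * h - t) - U 0 (real n * h - t - h))"
      unfolding S_def x left_diff_distrib sum_subtractf by (simp add: algebra_simps)
    then show ?thesis by (simp only: W_diff \<Psi>_def) (simp add: D_def)
  qed
  have cont\<Psi>: "continuous_on A (\<lambda>t. \<kappa> t * \<Psi> t)" for A
    unfolding S_diff[symmetric] by (intro continuous_on_mult continuous_on_diff contS cont_\<kappa>)
  have "\<delta> n - \<delta> (n - 1) = integral {0..R} (\<lambda>t. \<kappa> t * S (real n * h) t - \<kappa> t * S (real (n - 1) * h) t)"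
    unfolding \<delta>[OF order_refl] \<delta>[OF diff_le_self]
    by (intro integral_diff[symmetric] integrable_continuous_real continuous_on_mult contS cont_\<kappa>)
  also have "\<dots> = integral {0..R} (\<lambda>t. \<kappa> t * \<Psi> t)"
    unfolding right_diff_distrib[symmetric] S_diff ..
  also have "\<dots> = integral {0..h} (\<lambda>t. \<kappa> t * \<Psi> t) + integral {h..R} (\<lambda>t. \<kappa> t * \<Psi> t)"
    using h hR by (intro Henstock_Kurzweil_Integration.integral_combine[symmetric]
      integrable_continuous_real cont\<Psi>) auto
  finally have split: "\<delta> n - \<delta> (n - 1) =
    integral {0..h} (\<lambda>t. \<kappa> t * \<Psi> t) + integral {h..R} (\<lambda>t. \<kappa> t * \<Psi> t)" .

  \<comment> \<open>The Taylor bound is two-sided and asks for control up to \<open>x + h\<close>;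
    added to the reach \<open>2 * h\<close> of the stencil, this explains the margin
    \<open>3 * h\<close> in the assumption on \<open>U 4\<close>.\<close>
  have diff: "\<bar>D p x\<bar> \<le> M * h" if "p < 5" "\<And>y. y \<le> x + h \<Longrightarrow> \<bar>U (Suc p) y\<bar> \<le> M" for p x M
  proof -
    have "\<bar>U p (x + (- h)) - (\<Sum>m<1. U (m + p) x / fact m * (- h) ^ m)\<bar> \<le> M / fact 1 * \<bar>- h\<bar> ^ 1"
      using taylor_remainder_bound[of 1 "\<lambda>m. U (m + p)" x "- h" M] der[of p] that h by auto
    then show ?thesis using h by (simp add: D_def abs_minus_commute)
  qed
  have D3: "\<bar>D 3 x\<bar> \<le> M4 * h" if "x \<le> real n * h + 2 * h" for x
    using that by (intro diff) (auto intro!: M4)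
  have D4: "\<bar>D 4 x\<bar> \<le> M5 * h" for x
    by (intro diff) (auto intro!: M5)
  have Dder: "(D p has_real_derivative D (Suc p) x) (at x)" if "p < 4" for p x
  proof -
    have "((\<lambda>x. U p (x + - h)) has_real_derivative U (Suc p) (x + - h)) (at x)"
      using DERIV_shift[of "U p" "U (Suc p) (x + - h)" x "- h"] der[of p "x + - h"] that by simp
    then show ?thesis
      unfolding D_def using der[of p x] that by (auto intro!: derivative_intros)
  qed
  have Dzero: "D 0 x = 0" "D 2 x = 0" if "x \<le> 0" for x
    using zero that h by (simp_all add: D_def)
  have \<Psi>1: "\<bar>\<Psi> t\<bar> \<le> 20 * (M4 * h) * h ^ 3" if "t \<in> {0..h}" for t
    unfolding \<Psi>_def using that h D3 D4 Dzero Dder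
    by (intro spline_approximation_error(1)[where F = D and ?M3.0 = "M4 * h" and ?M4.0 = "M5 * h"]) auto
  have \<Psi>2: "\<bar>\<Psi> t\<bar> \<le> (M5 * h) * h ^ 4" if "h \<le> t" for t
    unfolding \<Psi>_def using that h D3 D4 Dzero Dder
    by (intro spline_approximation_error(2)[where F = D and ?M3.0 = "M4 * h" and ?M4.0 = "M5 * h"]) auto
  \<comment> \<open>On the runout cell a fourth power of \<open>h\<close> is multiplied by the
    length \<open>h\<close>; on the rest the integrand itself already has a fifth power.\<close>
  have "norm (integral {0..h} (\<lambda>t. \<kappa> t * \<Psi> t)) \<le> B * (20 * (M4 * h) * h ^ 3) * (h - 0)"
    using h hR \<kappa> \<Psi>1 \<open>0 \<le> B\<close>
    by (intro integral_bound cont\<Psi>) (auto simp: abs_mult intro!: mult_mono)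
  moreover have "norm (integral {h..R} (\<lambda>t. \<kappa> t * \<Psi> t)) \<le> B * ((M5 * h) * h ^ 4) * (R - h)"
    using h hR \<kappa> \<Psi>2 \<open>0 \<le> B\<close>
    by (intro integral_bound cont\<Psi>) (auto simp: abs_mult intro!: mult_mono)
  moreover have "B * ((M5 * h) * h ^ 4) * (R - h) \<le> B * ((M5 * h) * h ^ 4) * R"
    using \<open>0 \<le> B\<close> \<open>0 \<le> M5\<close> h by (intro mult_left_mono) auto
  ultimately have "\<bar>\<delta> n - \<delta> (n - 1)\<bar> \<le> B * (20 * (M4 * h) * h ^ 3) * h + B * ((M5 * h) * h ^ 4) * R"
    unfolding split real_norm_def diff_zero by linarith
  also have "\<dots> = B * (20 * M4 + R * M5) * h ^ 5"
    by (simp add: algebra_simps eval_nat_numeral)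
  finally show ?thesis .
qed

section \<open>Convergence\<close>

text \<open>The weight of index \<open>j\<close> sees the kernel only up to
  \<open>(j + 2) * h\<close>, so for \<open>j \<le> n - 2\<close> it stays within
  \<open>{0..T}\<close>. The index \<open>n - 1\<close>, which multiplies \<open>v 1\<close>,
  reaches at most \<open>T + h\<close>; this is why the comparison interval ends at
  \<open>T + 1\<close>.\<close>

lemma kernel_extension_perturbation:
  assumes h: "h > 0" "h \<le> 1" and zero: "v 0 = 0" and n: "real n * h \<le> T"
    and K: "K absolutely_integrable_on {0..T + 1}" and eq: "\<And>t. t \<in> {0..T} \<Longrightarrow> K t = \<kappa> t"
    and cont: "continuous_on UNIV \<kappa>"
  shows "\<bar>(\<Sum>j=0..n. weight \<kappa> h j * v (n - j)) - (\<Sum>j=0..n. weight K h j * v (n - j))\<bar>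
    \<le> 4 * integral {0..T + 1} (\<lambda>t. \<bar>K t - \<kappa> t\<bar>) * \<bar>v 1\<bar>"
proof (cases "n = 0")
  case True
  have "(\<lambda>t. K t - \<kappa> t) absolutely_integrable_on {0..T + 1}"
    by (intro set_integral_diff K absolutely_integrable_continuous_real continuous_on_subset[OF cont]) auto
  then have "0 \<le> integral {0..T + 1} (\<lambda>t. \<bar>K t - \<kappa> t\<bar>)"
    by (intro integral_nonneg) (auto simp: absolutely_integrable_on_def)
  then show ?thesis using True zero by simp
next
  case False
  let ?d = "\<lambda>j. (weight \<kappa> h j - weight K h j) * v (n - j)"
  have "(\<Sum>j=0..n. weight \<kappa> h j * v (n - j)) - (\<Sum>j=0..n. weight K h j * v (n - j)) = (\<Sum>j=0..n. ?d j)"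
    by (simp add: left_diff_distrib sum_subtractf)
  also have "\<dots> = (\<Sum>j\<in>{n - 1}. ?d j)"
  proof (rule sum.mono_neutral_right)
    show "\<forall>j\<in>{0..n} - {n - 1}. ?d j = 0"
    proof
      fix j assume j: "j \<in> {0..n} - {n - 1}"
      show "?d j = 0"
      proof (cases "j = n")
        case True
        then show ?thesis using zero by simp
      next
        case False
        then have "real j + 2 \<le> real n" using j by auto
        then have "(real j + 2) * h \<le> real n * h" using h by (intro mult_right_mono) auto
        then have "(real j + 2) * h \<le> T" using n by linarith
        then have "weight K h j = weight \<kappa> h j"
          using h n eq by (intro weight_cong[of _ _ T]) auto
        then show ?thesis by simp
      qed
    qed
  qed auto
  also have "\<bar>\<dots>\<bar> \<le> 4 * integral {0..T + 1} (\<lambda>t. \<bar>K t - \<kappa> t\<bar>) * \<bar>v 1\<bar>"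
  proof -
    have "(real (n - 1) + 2) * h = real n * h + h" using False by (simp add: of_nat_diff algebra_simps)
    then have "\<bar>weight K h (n - 1) - weight \<kappa> h (n - 1)\<bar> \<le> 4 * integral {0..T + 1} (\<lambda>t. \<bar>K t - \<kappa> t\<bar>)"
      using h n by (intro weight_diff_bound K continuous_on_subset[OF cont]) auto
    then show ?thesis
      using False by (simp add: abs_mult abs_minus_commute mult_right_mono)
  qed
  finally show ?thesis .
qed

text \<open>Each near-diagonal weight is known up to \<open>100 * L * h ^ 2\<close>, so a difference
  of two is known up to twice that; hence the rate \<open>200 * L\<close> in the recursion. The
  factor \<open>16\<close> is composed of two time levels, the bound \<open>4\<close> on a basis
  function, and the \<open>2\<close> in the bound on \<open>v 1\<close>.\<close>

lemma scheme_coefficients_error: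
  fixes U :: "nat \<Rightarrow> real \<Rightarrow> real"
  assumes h: "0 < h" "h \<le> 1" "2 * h \<le> T" "72 * (200 * L * h) \<le> 1"
    and lip: "\<And>x y. \<bar>\<kappa> x - \<kappa> y\<bar> \<le> L * \<bar>x - y\<bar>" and \<kappa>0: "\<kappa> 0 = 1"
    and cont: "continuous_on UNIV \<kappa>" and B: "\<And>t. t \<in> {0..T + 2} \<Longrightarrow> \<bar>\<kappa> t\<bar> \<le> B"
    and K: "K absolutely_integrable_on {0..T + 1}" and eq: "\<And>t. t \<in> {0..T} \<Longrightarrow> K t = \<kappa> t"
    and der: "\<And>p x. p < 5 \<Longrightarrow> (U p has_real_derivative U (Suc p) x) (at x)"
    and M4: "\<And>x. x \<le> T + 3 \<Longrightarrow> \<bar>U 4 x\<bar> \<le> M4" and M5: "\<And>x. \<bar>U 5 x\<bar> \<le> M5"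
    and zero: "\<And>x. x \<le> 0 \<Longrightarrow> U 0 x = 0" "\<And>x. x \<le> 0 \<Longrightarrow> U 2 x = 0"
    and volterra: "\<And>t. t \<in> {0..T} \<Longrightarrow> integral {0..t} (\<lambda>s. \<kappa> s * U 0 (t - s)) = a t"
    and a: "\<And>t. t \<in> {0..T} \<Longrightarrow> \<bar>a t\<bar> \<le> Ca * t ^ 7"
    and v: "scheme_coefficients T K a h v"
    and n: "real n * h \<le> T"
    and C: "B * (20 * M4 + (T + 2) * M5) + 16 * Ca * integral {0..T + 1} (\<lambda>t. \<bar>K t - \<kappa> t\<bar>) \<le> C" "0 \<le> C"
  shows "v 0 = 0"
    and "\<bar>v n - spline_coeff h U (real n * h)\<bar> \<le> (18 * C + 1) * exp ((18 * (200 * L) + 1) * T) * h ^ 4"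
proof -
  define I where "I = integral {0..T + 1} (\<lambda>t. \<bar>K t - \<kappa> t\<bar>)"
  define q where "q = weight \<kappa> h"
  define \<epsilon> where "\<epsilon> = (\<lambda>n. v n - spline_coeff h U (real n * h))"
  have "T > 0" using h by auto
  have L: "0 \<le> L" using order_trans[OF abs_ge_zero lip[of 1 0]] by simp
  have near: "\<bar>q j - h * runout_mass j\<bar> \<le> 100 * L * h ^ 2" if "j \<le> 3" for j
    unfolding q_def using h lip \<kappa>0 cont that by (intro weight_near_diagonal)
  have Lh: "100 * L * h ^ 2 \<le> h / 144"
    using mult_right_mono[OF h(4), of h] h(1) by (simp add: power2_eq_square)
  have q0: "q 0 \<ge> h / 2"
    using near[of 0] Lh h(1) by (simp add: runout_mass_def)
  \<comment> \<open>The condition \<open>2 * h \<le> T\<close> keeps the first support where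
    \<open>K\<close> and \<open>\<kappa>\<close> agree.\<close>
  have K0: "weight K h 0 = q 0"
    unfolding q_def using h eq by (intro weight_cong[of _ _ T]) auto
  have scheme: "(\<Sum>j=0..m. weight K h j * v (m - j)) = a (real m * h)" if "real m * h \<le> T" for m
    using v that by (simp add: scheme_coefficients_def)
  have "a 0 = 0" using a[of 0] \<open>T > 0\<close> by simp
  then show v0: "v 0 = 0" using scheme[of 0] K0 q0 h(1) \<open>T > 0\<close> by simp
  \<comment> \<open>\<open>a\<close> vanishes to seventh order, and dividing by
    \<open>q 0 \<ge> h / 2\<close> costs only one power of \<open>h\<close>.\<close>
  have "q 0 * v 1 = a h"
    using scheme[of 1] K0 v0 h by simp
  then have "\<bar>q 0\<bar> * \<bar>v 1\<bar> \<le> Ca * h ^ 7" using a[of h] h by (simp flip: abs_mult)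
  moreover have "h / 2 * \<bar>v 1\<bar> \<le> \<bar>q 0\<bar> * \<bar>v 1\<bar>"
    using q0 by (intro mult_right_mono) auto
  moreover have "h * (2 * Ca * h ^ 6) = 2 * (Ca * h ^ 7)" by (simp add: eval_nat_numeral)
  ultimately have "h * \<bar>v 1\<bar> \<le> h * (2 * Ca * h ^ 6)" by linarith
  then have v1: "\<bar>v 1\<bar> \<le> 2 * Ca * h ^ 6" using h(1) by simp
  have "0 \<le> Ca" using order_trans[OF abs_ge_zero v1] h(1) by (simp add: zero_le_mult_iff)
  have "h ^ 6 \<le> h ^ 5" using h by (intro power_decreasing) auto
  then have v1: "\<bar>v 1\<bar> \<le> 2 * Ca * h ^ 5"
    using order_trans[OF v1 mult_left_mono[of "h ^ 6" "h ^ 5" "2 * Ca"]] \<open>0 \<le> Ca\<close> by simp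
  have "(\<lambda>t. K t - \<kappa> t) absolutely_integrable_on {0..T + 1}"
    by (intro set_integral_diff K absolutely_integrable_continuous_real continuous_on_subset[OF cont]) auto
  then have "0 \<le> I"
    unfolding I_def by (intro integral_nonneg) (auto simp: absolutely_integrable_on_def)
  \<comment> \<open>\<open>\<rho>\<close> is the residual of the computed coefficients under the
    extended kernel and is of order \<open>h ^ 5\<close> by itself. The defect
    \<open>\<delta>\<close> of the exact coefficients, defined below, is estimated only after
    differencing.\<close>
  define \<rho> where "\<rho> = (\<lambda>m. (\<Sum>j=0..m. q j * v (m - j)) - a (real m * h))"
  have \<rho>: "\<bar>\<rho> m\<bar> \<le> 8 * Ca * I * h ^ 5" if m: "real m * h \<le> T" for m
  proof -
    have "\<bar>\<rho> m\<bar> \<le> 4 * I * \<bar>v 1\<bar>"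
      unfolding \<rho>_def q_def I_def scheme[OF m, symmetric]
      using h v0 m K eq cont by (intro kernel_extension_perturbation) auto
    also have "\<dots> \<le> 4 * I * (2 * Ca * h ^ 5)"
      using v1 \<open>0 \<le> I\<close> by (intro mult_left_mono) auto
    finally show ?thesis by (simp add: ac_simps)
  qed
  define \<delta> where "\<delta> = (\<lambda>m. (\<Sum>j=0..m. q j * spline_coeff h U (real (m - j) * h)) - a (real m * h))"
  have \<delta>: "\<bar>\<delta> m - \<delta> (m - 1)\<bar> \<le> B * (20 * M4 + (T + 2) * M5) * h ^ 5"
    if m: "1 \<le> m" "m \<le> n" for m
    unfolding \<delta>_def q_def
  proof (rule scheme_consistency[OF h(1) cont _ B der _ M5 zero _ m(1)])
    have mT: "real m' * h \<le> T" if "m' \<le> m" for m'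
      using order_trans[OF mult_right_mono[of "real m'" "real n" h] n] that m h by simp
    show "(real m + 2) * h \<le> T + 2" using mT[of m] h by (simp add: distrib_right)
    show "integral {0..real m' * h} (\<lambda>s. \<kappa> s * U 0 (real m' * h - s)) = a (real m' * h)" if "m' \<le> m" for m'
      using mT[OF that] h by (intro volterra) auto
    show "\<bar>U 4 x\<bar> \<le> M4" if "x \<le> real m * h + 3 * h" for x
      using mT[of m] h that by (intro M4) auto
  qed
  have conv: "(\<Sum>j=0..m. q j * \<epsilon> (m - j)) = \<rho> m - \<delta> m" for m
    by (simp add: \<rho>_def \<delta>_def \<epsilon>_def right_diff_distrib sum_subtractf)
  have residual: "\<bar>(\<Sum>j=0..m. q j * \<epsilon> (m - j)) - (\<Sum>j=0..m-1. q j * \<epsilon> (m - 1 - j))\<bar> \<le> C * h ^ 5"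
    if m: "1 \<le> m" "m \<le> n" for m
  proof -
    have "real m * h \<le> T" "real (m - 1) * h \<le> T"
      using order_trans[OF mult_right_mono[of "real m" "real n" h] n]
        order_trans[OF mult_right_mono[of "real (m - 1)" "real n" h] n] m h by simp_all
    then have "\<bar>(\<rho> m - \<delta> m) - (\<rho> (m - 1) - \<delta> (m - 1))\<bar>
        \<le> B * (20 * M4 + (T + 2) * M5) * h ^ 5 + 8 * Ca * I * h ^ 5 + 8 * Ca * I * h ^ 5"
      using \<rho>[of m] \<rho>[of "m - 1"] \<delta>[OF m] by linarith
    also have "\<dots> = (B * (20 * M4 + (T + 2) * M5) + 16 * Ca * I) * h ^ 5"
      by (simp add: algebra_simps)
    also have "\<dots> \<le> C * h ^ 5" using C(1) h by (intro mult_right_mono) (auto simp: I_def)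
    finally show ?thesis unfolding conv .
  qed
  have mass: "\<bar>q (Suc j) - q j\<bar> \<le> \<bar>runout_mass (Suc j) - runout_mass j\<bar> * h + 200 * L * h * h"
    if "j < 3" for j
  proof -
    have "\<bar>q (Suc j) - q j\<bar> \<le> \<bar>h * runout_mass (Suc j) - h * runout_mass j\<bar> + 200 * L * h * h"
      using near[of "Suc j"] near[of j] that unfolding power2_eq_square by linarith
    also have "\<bar>h * runout_mass (Suc j) - h * runout_mass j\<bar> = \<bar>runout_mass (Suc j) - runout_mass j\<bar> * h"
      using h(1) by (simp add: abs_mult mult.commute flip: right_diff_distrib)
    finally show ?thesis .
  qed
  have "\<bar>\<epsilon> n\<bar> \<le> (18 * C + 1) * h ^ 4 * (1 + (18 * (200 * L) + 1) * h) ^ n"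
  proof (rule recursion_stability[where N = n and q = q])
    show "(15 / 24 - 200 * L * h) * h \<le> q 0"
      using near[of 0] L h(1) mult_nonneg_nonneg[of L "h ^ 2"]
      by (simp add: runout_mass_def power2_eq_square algebra_simps)
    show "\<bar>q 1 - q 0\<bar> \<le> (5 / 24 + 200 * L * h) * h"
      using mass[of 0] by (simp add: runout_mass_def distrib_right)
    show "\<bar>q 2 - q 1\<bar> \<le> (5 / 24 + 200 * L * h) * h"
      using mass[of 1] by (simp add: runout_mass_def distrib_right eval_nat_numeral)
    show "\<bar>q 3 - q 2\<bar> \<le> (1 / 24 + 200 * L * h) * h"
      using mass[of 2] by (simp add: runout_mass_def distrib_right eval_nat_numeral)
    show "\<bar>q j - q (j - 1)\<bar> \<le> 200 * L * h * h" if "4 \<le> j" for j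
    proof -
      have "\<bar>q j - q (j - 1)\<bar> \<le> 4 * L * h ^ 2"
        unfolding q_def using h lip cont that by (intro weight_far_diff)
      also have "\<dots> \<le> 200 * L * h ^ 2" using L by (intro mult_right_mono) auto
      finally show ?thesis by (simp add: power2_eq_square)
    qed
    show "\<epsilon> 0 = 0" using v0 zero by (simp add: \<epsilon>_def spline_coeff_def)
  qed (use h L C residual in auto)
  also have "\<dots> \<le> (18 * C + 1) * h ^ 4 * exp ((18 * (200 * L) + 1) * T)"
  proof (rule mult_left_mono)
    let ?\<beta> = "18 * (200 * L) + 1"
    have "(1 + ?\<beta> * h) ^ n \<le> exp (?\<beta> * h) ^ n"
      using L h by (intro power_mono exp_ge_add_one_self) auto
    also have "\<dots> = exp (?\<beta> * (real n * h))"
      by (simp add: exp_of_nat_mult[symmetric] ac_simps)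
    also have "\<dots> \<le> exp (?\<beta> * T)"
      using n L by (simp add: mult_left_mono)
    finally show "(1 + ?\<beta> * h) ^ n \<le> exp (?\<beta> * T)" .
  qed (use C h in auto)
  finally show "\<bar>v n - spline_coeff h U (real n * h)\<bar> \<le> (18 * C + 1) * exp ((18 * (200 * L) + 1) * T) * h ^ 4"
    by (simp add: \<epsilon>_def ac_simps)
qed

theorem theorem5p1:
  fixes T :: real and d :: nat and a K u :: "real \<Rightarrow> real"
  assumes "T > 0" and "d \<ge> 6"
    and "C_on (d + 1) {0..T} a"
    and "C_on (d + 1) {0..T} K"
    and "locally_integrable_halfline K"
    and "K 0 = 1"
    and "\<forall>p\<le>d + 1. nth_deriv_within {0..T} p a 0 = 0"
    and "volterra_solution d T K a u"
  shows "\<exists>C. \<forall>\<^sub>F h in at_right 0.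
           \<forall>v. scheme_coefficients T K a h v \<longrightarrow>
             (\<forall>n\<ge>1. real n * h \<le> T \<longrightarrow>
               (\<forall>t\<in>{h..real n * h}. \<bar>approx_error u h v n t\<bar> \<le> C * h ^ 4))"
proof -
  have u: "C_on d {0..T} u" "\<And>t. t < 0 \<Longrightarrow> u t = 0"
    "\<And>t. t \<in> {0..T} \<Longrightarrow> integral {0..t} (\<lambda>s. K s * u (t - s)) = a t"
    using assms(8) by (auto simp: volterra_solution_def)
  have "1 \<le> d + 1" "7 \<le> d + 1" "6 \<le> d" "5 \<le> d" using \<open>d \<ge> 6\<close> by auto

  \<comment> \<open>One derivative of the extension, bounded on the whole line, makes
    \<open>\<kappa>\<close> globally Lipschitz.\<close>
  obtain k L where k: "\<And>p x. p < 1 \<Longrightarrow> (k p has_real_derivative k (Suc p) x) (at x)"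
    "\<And>p x. p \<le> 1 \<Longrightarrow> x \<in> {0..T} \<Longrightarrow> k p x = nth_deriv_within {0..T} p K x"
    "\<And>p. p \<le> 1 \<Longrightarrow> continuous_on UNIV (k p)"
    "\<And>x. x \<le> 0 \<Longrightarrow> k 1 x = nth_deriv_within {0..T} 1 K 0" "\<And>x. \<bar>k 1 x\<bar> \<le> L"
    by (rule C_on_smooth_extension[OF \<open>T > 0\<close> assms(4) \<open>1 \<le> d + 1\<close>]) (rule that)
  define \<kappa> where "\<kappa> = k 0"
  have \<kappa>K: "K t = \<kappa> t" if "t \<in> {0..T}" for t using k(2)[of 0 t] that by (simp add: \<kappa>_def)
  have cont: "continuous_on UNIV \<kappa>" using k(3)[of 0] by (simp add: \<kappa>_def)
  have lip: "\<bar>\<kappa> x - \<kappa> y\<bar> \<le> L * \<bar>x - y\<bar>" for x y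
    using taylor_remainder_bound[of 1 k y "x - y" L] k(1,5) by (simp add: \<kappa>_def)
  have \<kappa>0: "\<kappa> 0 = 1" using \<kappa>K[of 0] \<open>K 0 = 1\<close> \<open>T > 0\<close> by simp
  have L: "0 \<le> L" using order_trans[OF abs_ge_zero lip[of 1 0]] by simp

  \<comment> \<open>All Taylor coefficients of \<open>a\<close> below order seven vanish at
    \<open>0\<close>, which yields \<open>a t = O(t ^ 7)\<close>.\<close>
  obtain A Ca where A: "\<And>p x. p < 7 \<Longrightarrow> (A p has_real_derivative A (Suc p) x) (at x)"
    "\<And>p x. p \<le> 7 \<Longrightarrow> x \<in> {0..T} \<Longrightarrow> A p x = nth_deriv_within {0..T} p a x"
    "\<And>p. p \<le> 7 \<Longrightarrow> continuous_on UNIV (A p)"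
    "\<And>x. x \<le> 0 \<Longrightarrow> A 7 x = nth_deriv_within {0..T} 7 a 0" "\<And>x. \<bar>A 7 x\<bar> \<le> Ca"
    by (rule C_on_smooth_extension[OF \<open>T > 0\<close> assms(3) \<open>7 \<le> d + 1\<close>]) (rule that)
  have a: "\<bar>a t\<bar> \<le> Ca / fact 7 * t ^ 7" if t: "t \<in> {0..T}" for t
  proof -
    have "\<bar>A 0 (0 + t) - (\<Sum>m<7. A m 0 / fact m * t ^ m)\<bar> \<le> Ca / fact 7 * \<bar>t\<bar> ^ 7"
      using A(1,5) by (intro taylor_remainder_bound)
    moreover have "A m 0 = 0" if "m < 7" for m
      using A(2)[of m 0] assms(7) that \<open>d \<ge> 6\<close> \<open>T > 0\<close> by simp
    ultimately show ?thesis using t A(2)[of 0 t] by simp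
  qed

  \<comment> \<open>This extension serves to show that the derivatives of \<open>u\<close> up to
    order \<open>5\<close> vanish at \<open>0\<close>; order \<open>6\<close> supplies the remainder
    for the last of them.\<close>
  obtain V MV where V: "\<And>p x. p < 6 \<Longrightarrow> (V p has_real_derivative V (Suc p) x) (at x)"
    "\<And>p x. p \<le> 6 \<Longrightarrow> x \<in> {0..T} \<Longrightarrow> V p x = nth_deriv_within {0..T} p u x"
    "\<And>p. p \<le> 6 \<Longrightarrow> continuous_on UNIV (V p)"
    "\<And>x. x \<le> 0 \<Longrightarrow> V 6 x = nth_deriv_within {0..T} 6 u 0" "\<And>x. \<bar>V 6 x\<bar> \<le> MV"
    by (rule C_on_smooth_extension[OF \<open>T > 0\<close> u(1) \<open>6 \<le> d\<close>]) (rule that)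
  have volterra: "integral {0..t} (\<lambda>s. \<kappa> s * w (t - s)) = a t"
    if "t \<in> {0..T}" "\<And>x. x \<in> {0..T} \<Longrightarrow> w x = u x" for t w
    unfolding u(3)[OF that(1), symmetric] using that \<kappa>K by (intro integral_cong) auto
  have u_zero: "nth_deriv_within {0..T} p u 0 = 0" if "p \<le> 5" for p
  proof -
    have "V p 0 = 0"
    proof (rule volterra_derivatives_vanish[where \<kappa> = \<kappa> and V = V and k = 6, OF \<open>T > 0\<close> lip \<kappa>0 cont V(1,3)])
      show "integral {0..t} (\<lambda>s. \<kappa> s * V 0 (t - s)) = a t" if "t \<in> {0..T}" for t
        using that V(2)[of 0] by (intro volterra) auto
      show "\<bar>a t\<bar> \<le> Ca / fact 7 * t ^ Suc 6" if "t \<in> {0..T}" for t using a[OF that] by simp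
    qed (use that in auto)
    then show ?thesis using V(2)[of p 0] that \<open>T > 0\<close> by simp
  qed

  \<comment> \<open>A fresh extension of order \<open>5\<close>: its top derivative continues to the
    left with the value zero, so \<open>U\<close> vanishes on the negative axis. An extension of
    order \<open>6\<close> would continue with the sixth derivative at \<open>0\<close>, which has
    not been shown to vanish.\<close>
  obtain U M5 where U: "\<And>p x. p < 5 \<Longrightarrow> (U p has_real_derivative U (Suc p) x) (at x)"
    "\<And>p x. p \<le> 5 \<Longrightarrow> x \<in> {0..T} \<Longrightarrow> U p x = nth_deriv_within {0..T} p u x"
    "\<And>p. p \<le> 5 \<Longrightarrow> continuous_on UNIV (U p)"
    "\<And>x. x \<le> 0 \<Longrightarrow> U 5 x = nth_deriv_within {0..T} 5 u 0" "\<And>x. \<bar>U 5 x\<bar> \<le> M5"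
    by (rule C_on_smooth_extension[OF \<open>T > 0\<close> u(1) \<open>5 \<le> d\<close>]) (rule that)
  have U0: "U p x = 0" if "p \<le> 5" "x \<le> 0" for p x
    using vanishing_extension[of 5 U p x] U(1,2,4) u_zero that \<open>T > 0\<close> by simp
  have Uu: "U 0 x = u x" if "x \<in> {0..T}" for x using U(2)[of 0 x] that by simp
  obtain M4 where M4: "0 \<le> M4" "\<And>x. x \<in> {0..T + 3} \<Longrightarrow> \<bar>U 4 x\<bar> \<le> M4"
    by (rule continuous_on_UNIV_bounded[OF U(3), of 4]) (auto intro: that)
  have M4': "\<bar>U 4 x\<bar> \<le> M4" if "x \<le> T + 3" for x
    using M4 U0[of 4 x] that by (cases "x \<le> 0") auto
  obtain B where B: "0 \<le> B" "\<And>x. x \<in> {0..T + 2} \<Longrightarrow> \<bar>\<kappa> x\<bar> \<le> B"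
    by (rule continuous_on_UNIV_bounded[OF cont]) (auto intro: that)
  have K: "K absolutely_integrable_on {0..T + 1}"
    using assms(5) by (simp add: locally_integrable_halfline_def)

  \<comment> \<open>Nothing here depends on \<open>h\<close> or \<open>n\<close>; the integral is a
    fixed number measuring how far \<open>K\<close> departs from its extension beyond
    \<open>T\<close>.\<close>
  define C where "C = max 0 (B * (20 * M4 + (T + 2) * M5)
    + 16 * (Ca / fact 7) * integral {0..T + 1} (\<lambda>t. \<bar>K t - \<kappa> t\<bar>))"
  define E where "E = (18 * C + 1) * exp ((18 * (200 * L) + 1) * T)"
  have E: "0 \<le> E" by (simp add: E_def C_def)
  have bound: "\<bar>approx_error u h v n t\<bar> \<le> (M4 + 4 * E) * h ^ 4"
    if h: "0 < h" "h \<le> 1" "2 * h \<le> T" "72 * (200 * L * h) \<le> 1"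
      and v: "scheme_coefficients T K a h v" and n: "real n * h \<le> T" and t: "t \<in> {h..real n * h}"
    for h v n t
  proof -
    define \<epsilon> where "\<epsilon> = (\<lambda>n. v n - spline_coeff h U (real n * h))"
    have err: "v 0 = 0" "\<bar>\<epsilon> m\<bar> \<le> E * h ^ 4" if "m \<le> n" for m
    proof -
      have m: "real m * h \<le> T"
        using order_trans[OF mult_right_mono[of "real m" "real n" h] n] that h by simp
      note * = scheme_coefficients_error[where \<kappa> = \<kappa> and U = U, OF h lip \<kappa>0 cont B(2) K \<kappa>K U(1) M4' U(5) _ _ _ a v m, of C]
      show "v 0 = 0" by (rule *(1)) (auto simp: U0 C_def intro!: volterra Uu)
      show "\<bar>\<epsilon> m\<bar> \<le> E * h ^ 4"
        unfolding \<epsilon>_def E_def by (rule *(2)) (auto simp: U0 C_def intro!: volterra Uu)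
    qed
    have \<epsilon>0: "\<epsilon> 0 = 0" using err(1)[of 0] U0 by (simp add: \<epsilon>_def spline_coeff_def)
    \<comment> \<open>The spline with exact coefficients is separated from the one carrying the
      coefficient errors; with \<open>t \<ge> h\<close>, both are evaluated outside the runout
      cell.\<close>
    let ?S = "\<Sum>j=0..n. spline_coeff h U (real n * h - real j * h) * runout_basis j (t / h)"
    have "approx h v n (real n * h - t) = (\<Sum>j=0..n. v (n - j) * runout_basis j (t / h))"
      by (simp add: approx_def)
    also have "\<dots> = (\<Sum>j=0..n. spline_coeff h U (real n * h - real j * h) * runout_basis j (t / h)
      + \<epsilon> (n - j) * runout_basis j (t / h))"
      by (intro sum.cong) (auto simp: \<epsilon>_def of_nat_diff algebra_simps)
    also have "\<dots> = ?S + (\<Sum>j=0..n. \<epsilon> (n - j) * runout_basis j (t / h))"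
      by (rule sum.distrib)
    finally have app: "approx h v n (real n * h - t)
      = ?S + (\<Sum>j=0..n. \<epsilon> (n - j) * runout_basis j (t / h))" .
    have "\<bar>\<Sum>j=0..n. \<epsilon> (n - j) * runout_basis j (t / h)\<bar> \<le> 4 * (E * h ^ 4)"
      using err(2) \<epsilon>0 t h by (intro runout_sum_bound) auto
    moreover obtain M3 where M3: "0 \<le> M3" "\<And>x. x \<in> {0..T + 3} \<Longrightarrow> \<bar>U 3 x\<bar> \<le> M3"
      by (rule continuous_on_UNIV_bounded[OF U(3), of 3]) (auto intro: that)
    have "\<bar>U 3 x\<bar> \<le> M3" if "x \<le> T + 3" for x
      using M3 U0[of 3 x] that by (cases "x \<le> 0") auto
    then have "\<bar>?S - U 0 (real n * h - t)\<bar> \<le> M4 * h ^ 4"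
      using t h n U(1) U0 M4' by (intro spline_approximation_error(2)[where ?M3.0 = M3]) auto
    moreover have "u (real n * h - t) = U 0 (real n * h - t)"
      using t n h by (intro Uu[symmetric]) auto
    ultimately show ?thesis
      unfolding approx_error_def app distrib_right by linarith
  qed
  \<comment> \<open>One entry for each smallness condition on \<open>h\<close>; \<open>L + 1\<close>
    keeps the last quotient defined when \<open>L = 0\<close>.\<close>
  define h0 where "h0 = min 1 (min (T / 2) (1 / (72 * 200 * (L + 1))))"
  have "h0 > 0" using \<open>T > 0\<close> L by (simp add: h0_def)
  have small: "h \<le> 1 \<and> 2 * h \<le> T \<and> 72 * (200 * L * h) \<le> 1" if "0 < h" "h < h0" for h
  proof -
    have "h \<le> 1 / (72 * 200 * (L + 1))" using that by (simp add: h0_def)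
    then have "h * (72 * 200 * (L + 1)) \<le> 1" using L by (simp add: pos_le_divide_eq)
    then show ?thesis using that by (simp add: h0_def algebra_simps)
  qed
  show ?thesis
  proof (intro exI[of _ "M4 + 4 * E"])
    show "\<forall>\<^sub>F h in at_right 0. \<forall>v. scheme_coefficients T K a h v \<longrightarrow>
      (\<forall>n\<ge>1. real n * h \<le> T \<longrightarrow>
        (\<forall>t\<in>{h..real n * h}. \<bar>approx_error u h v n t\<bar> \<le> (M4 + 4 * E) * h ^ 4))"
      unfolding eventually_at_right_field using \<open>h0 > 0\<close> small bound by blast
  qed
qed

end
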